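(* Fix a prime power $q$ and an integer $g\ge0$. For $n\ge1$ let $c_n$ be a regular elliptic element of $\mathrm{GL}_n(\mathbb{F}_q)$ and let $N_g(n)$ be the number of pairs $(u,v)\in\mathrm{GL}_n(\mathbb{F}_q)^2$ with $u\cdot v=c_n$ and $n-\dim\ker(u-1)-\dim\ker(v-1)=g$ (genus-$g$ factorizations into two factors). Then as $n\to\infty$, \[N_g(n)=\Theta\!\left(\frac{q^{(n+g)^2/2}}{|\mathrm{GL}_g(\mathbb{F}_q)|}\right),\] where the implicit constants depend on $q$ but not on $g$.
   Context: Regular elliptic element: the image in $\mathrm{GL}_n(\mathbb{F}_q)$ (via an $\mathbb{F}_q$-basis of $\mathbb{F}_{q^n}$, $\sigma$ acting by multiplication) of some $\sigma\in\mathbb{F}_{q^n}$ with $\mathbb{F}_q[\sigma]=\mathbb{F}_{q^n}$; when $n=1$ one additionally requires $c\neq1$. $|\mathrm{GL}_0(\mathbb{F}_q)|=1$. *)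

theory Defs
  imports "HOL-Analysis.Analysis" "Jordan_Normal_Form.Matrix_Kernel"
    "Jordan_Normal_Form.Jordan_Normal_Form"
begin

definition GL :: "nat \<Rightarrow> 'a::field mat set" where
  "GL n = {A \<in> carrier_mat n n. invertible_mat A}"

text \<open>Matrix of multiplication by x on F[x]/(f) w.r.t. the basis 1, x, ..., x^(n-1)
  (column j = coordinates of x * x^j mod f), where n = degree f.\<close>
definition mult_x_matrix :: "'a::field poly \<Rightarrow> 'a mat" where
  "mult_x_matrix f = mat (degree f) (degree f) (\<lambda>(i,j). coeff (monom 1 (j+1) mod f) i)"

text \<open>Regular elliptic element of GL_n(F_q): image of multiplication by some sigma in
  F_{q^n} with F_q[sigma] = F_{q^n}, w.r.t. some F_q-basis. We model F_{q^n} = F_q[sigma]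
  as F_q[x]/(f) with f the (irreducible, monic, degree n) minimal polynomial of sigma and
  sigma = x; a change of basis is conjugation by an invertible matrix.
  For n = 1 additionally c is not the identity.\<close>
definition regular_elliptic :: "nat \<Rightarrow> 'a::field mat \<Rightarrow> bool" where
  "regular_elliptic n c \<longleftrightarrow>
     c \<in> carrier_mat n n \<and>
     (\<exists>f::'a poly. monic f \<and> irreducible f \<and> degree f = n \<and>
        (\<exists>P Q. P \<in> carrier_mat n n \<and> Q \<in> carrier_mat n n \<and>
           P * Q = 1\<^sub>m n \<and> Q * P = 1\<^sub>m n \<and> c = P * mult_x_matrix f * Q)) \<and>
     (n = 1 \<longrightarrow> c \<noteq> 1\<^sub>m 1)"

definition N_genus :: "nat \<Rightarrow> nat \<Rightarrow> 'a::field mat \<Rightarrow> nat" where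
  "N_genus g n c = card {(u, v). u \<in> GL n \<and> v \<in> GL n \<and> u * v = c \<and>
      int n - int (kernel_dim (u - 1\<^sub>m n)) - int (kernel_dim (v - 1\<^sub>m n)) = int g}"

end

theory Submission
  imports Defs "Berlekamp_Zassenhaus.Berlekamp_Type_Based"
begin

text \<open>A factorization \<open>c = u v\<close> is determined by \<open>u\<close>, and \<open>ker (v - 1) = ker (u - c)\<close>. So the task is to
  count the \<open>u\<close> for which \<open>ker (u - 1)\<close> and \<open>ker (u - c)\<close> have dimensions \<open>a\<close> and \<open>b\<close> with \<open>a + b = n - g\<close>;
  all that matters about \<open>c\<close> is that neither 0 nor 1 is an eigenvalue. Equip each \<open>u\<close> with a basis of
  each of the two kernels: every \<open>u\<close> gets about \<open>q ^ (a^2 + b^2)\<close> such frames. A frame together with the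
  images under \<open>u\<close> of \<open>g\<close> further basis vectors determines \<open>u\<close>, so there are at most \<open>q ^ (n^2)\<close> framed
  \<open>u\<close>; conversely, choosing these \<open>n\<close> vectors one at a time outside the few (affine) subspaces that would
  destroy invertibility of \<open>u\<close> or enlarge a kernel shows that a positive proportion of all choices occurs.
  Hence there are about \<open>q ^ (n^2 - a^2 - b^2)\<close> such \<open>u\<close>, and since
  \<open>n^2 - a^2 - b^2 = (n + g)^2 / 2 - g^2 - (a - b)^2 / 2\<close>, the sum over \<open>a + b = n - g\<close> is dominated by
  \<open>a\<close> close to \<open>b\<close>.\<close>

section \<open>Linear algebra over a finite field\<close>

lemma (in vectorspace) card_carrier_eq_power_dim:
  assumes "finite A" "basis A"
  shows "card (carrier V) = card (carrier K) ^ dim"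
proof -
  have "A \<subseteq> carrier V" using assms(2) unfolding basis_def by auto
  from basis_criterion[OF assms(1) this] assms(2)
  have *: "\<And>v. v \<in> carrier V \<Longrightarrow> \<exists>!a. a \<in> A \<rightarrow>\<^sub>E carrier K \<and> lincomb a A = v" by auto
  have "bij_betw (\<lambda>a. lincomb a A) (A \<rightarrow>\<^sub>E carrier K) (carrier V)"
    unfolding bij_betw_def inj_on_def
  proof (intro conjI ballI impI equalityI subsetI)
    fix a b assume "a \<in> A \<rightarrow>\<^sub>E carrier K" "b \<in> A \<rightarrow>\<^sub>E carrier K" "lincomb a A = lincomb b A"
    moreover have "lincomb a A \<in> carrier V"
      using \<open>A \<subseteq> carrier V\<close> calculation(1) by (intro lincomb_closed) (auto simp: PiE_def)
    ultimately show "a = b" using * by metis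
  next
    fix v assume "v \<in> (\<lambda>a. lincomb a A) ` (A \<rightarrow>\<^sub>E carrier K)"
    then show "v \<in> carrier V" using \<open>A \<subseteq> carrier V\<close> by (auto intro!: lincomb_closed simp: PiE_def)
  next
    fix v assume "v \<in> carrier V"
    then show "v \<in> (\<lambda>a. lincomb a A) ` (A \<rightarrow>\<^sub>E carrier K)" using * by blast
  qed
  then have "card (carrier V) = card (A \<rightarrow>\<^sub>E carrier K)" by (simp add: bij_betw_same_card)
  also have "\<dots> = card (carrier K) ^ card A" using assms(1) by (simp add: card_funcsetE)
  also have "card A = dim" using dim_basis[OF assms] by simp
  finally show ?thesis .
qed

text \<open>This links \<open>kernel_dim\<close> to counting: dimensions are compared below by
  comparing powers of \<open>CARD('a)\<close>.\<close>

lemma card_mat_kernel: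
  fixes A :: "'a :: {field, finite} mat"
  shows "card (mat_kernel A) = CARD('a) ^ kernel_dim A"
proof -
  interpret kernel "dim_row A" "dim_col A" A by unfold_locales auto
  obtain B where "finite B" "basis B" using kernel_basis_exists[of A] by auto
  from Ker.card_carrier_eq_power_dim[OF this] show ?thesis by simp
qed

lemma two_le_card_field: "2 \<le> CARD('a::{finite,zero_neq_one})"
  using card_mono[of "UNIV :: 'a set" "{0, 1}"] by simp

section \<open>Subspaces, spans and independence for explicit lists of vectors\<close>

definition vsubspace :: "nat \<Rightarrow> 'a::field vec set \<Rightarrow> bool" where
  "vsubspace n W \<longleftrightarrow> W \<subseteq> carrier_vec n \<and> 0\<^sub>v n \<in> W \<and>
     (\<forall>x\<in>W. \<forall>y\<in>W. x + y \<in> W) \<and> (\<forall>k. \<forall>x\<in>W. k \<cdot>\<^sub>v x \<in> W)"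

fun vspan :: "nat \<Rightarrow> 'a::field vec list \<Rightarrow> 'a vec set" where
  "vspan n [] = {0\<^sub>v n}"
| "vspan n (w # ws) = (\<lambda>(k, y). k \<cdot>\<^sub>v w + y) ` (UNIV \<times> vspan n ws)"

text \<open>Recursion at the head suits counting by successive choices: if \<open>ws\<close> is
  independent, then \<open>x # ws\<close> is independent for exactly the \<open>x\<close> outside
  \<open>vspan n ws\<close>.\<close>

fun vindep :: "nat \<Rightarrow> 'a::field vec list \<Rightarrow> bool" where
  "vindep n [] = True"
| "vindep n (w # ws) = (w \<notin> vspan n ws \<and> vindep n ws)"

lemma vsubspace_subset: "vsubspace n W \<Longrightarrow> W \<subseteq> carrier_vec n"
  and vsubspace_zero: "vsubspace n W \<Longrightarrow> 0\<^sub>v n \<in> W"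
  and vsubspace_add: "vsubspace n W \<Longrightarrow> x \<in> W \<Longrightarrow> y \<in> W \<Longrightarrow> x + y \<in> W"
  and vsubspace_smult: "vsubspace n W \<Longrightarrow> x \<in> W \<Longrightarrow> k \<cdot>\<^sub>v x \<in> W"
  unfolding vsubspace_def by auto

lemma vsubspace_diff:
  assumes "vsubspace n W" "x \<in> W" "y \<in> W"
  shows "x - y \<in> W"
proof -
  have "x \<in> carrier_vec n" "y \<in> carrier_vec n" using assms vsubspace_subset by auto
  then have "x - y = x + (-1) \<cdot>\<^sub>v y" by (intro eq_vecI) auto
  then show ?thesis using assms by (auto intro: vsubspace_add vsubspace_smult)
qed

lemma vsubspace_carrier: "vsubspace n (carrier_vec n)"
  unfolding vsubspace_def by auto

lemma vsubspace_mat_kernel: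
  assumes "A \<in> carrier_mat m n"
  shows "vsubspace n (mat_kernel A)"
  unfolding vsubspace_def mat_kernel[OF assms]
  using assms mult_add_distrib_mat_vec[OF assms] mult_mat_vec[OF assms] by auto

lemma finite_vsubspace:
  fixes W :: "'a::{field,finite} vec set"
  shows "vsubspace n W \<Longrightarrow> finite W"
  by (rule finite_subset[OF vsubspace_subset finite_carrier_vec])

lemma vsubspace_vspan:
  assumes "set ws \<subseteq> carrier_vec n"
  shows "vsubspace n (vspan n ws)"
  using assms
proof (induction ws)
  case Nil
  then show ?case by (auto simp: vsubspace_def)
next
  case (Cons w ws)
  then have W: "vsubspace n (vspan n ws)" and w: "w \<in> carrier_vec n" by auto
  note sub = vsubspace_subset[OF W]
  show ?case
    unfolding vsubspace_def
  proof (intro conjI ballI allI)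
    show "vspan n (w # ws) \<subseteq> carrier_vec n" using w sub by auto
    have "0\<^sub>v n = 0 \<cdot>\<^sub>v w + 0\<^sub>v n" using w by auto
    then show "0\<^sub>v n \<in> vspan n (w # ws)" using vsubspace_zero[OF W] by force
  next
    fix x y assume "x \<in> vspan n (w # ws)" "y \<in> vspan n (w # ws)"
    then obtain k x' l y' where *: "x = k \<cdot>\<^sub>v w + x'" "y = l \<cdot>\<^sub>v w + y'"
      "x' \<in> vspan n ws" "y' \<in> vspan n ws" by auto
    then have "x' \<in> carrier_vec n" "y' \<in> carrier_vec n" using sub by auto
    then have "x + y = (k + l) \<cdot>\<^sub>v w + (x' + y')"
      using * w by (intro eq_vecI) (auto simp: algebra_simps)
    then show "x + y \<in> vspan n (w # ws)" using vsubspace_add[OF W *(3,4)] by force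
  next
    fix l x assume "x \<in> vspan n (w # ws)"
    then obtain k x' where *: "x = k \<cdot>\<^sub>v w + x'" "x' \<in> vspan n ws" by auto
    then have "x' \<in> carrier_vec n" using sub by auto
    then have "l \<cdot>\<^sub>v x = (l * k) \<cdot>\<^sub>v w + l \<cdot>\<^sub>v x'"
      using * w by (intro eq_vecI) (auto simp: algebra_simps)
    then show "l \<cdot>\<^sub>v x \<in> vspan n (w # ws)" using vsubspace_smult[OF W *(2)] by force
  qed
qed

lemma vspan_subset:
  assumes "vsubspace n W" "set ws \<subseteq> W"
  shows "vspan n ws \<subseteq> W"
  using assms(2)
proof (induction ws)
  case Nil
  then show ?case using vsubspace_zero[OF assms(1)] by auto
next
  case (Cons w ws)
  then show ?case by (auto intro!: vsubspace_add[OF assms(1)] vsubspace_smult[OF assms(1)])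
qed

lemma vspan_in_carrier: "set ws \<subseteq> carrier_vec n \<Longrightarrow> vspan n ws \<subseteq> carrier_vec n"
  by (rule vspan_subset[OF vsubspace_carrier])

lemma vspan_superset:
  assumes "set ws \<subseteq> carrier_vec n"
  shows "set ws \<subseteq> vspan n ws"
  using assms
proof (induction ws)
  case (Cons w ws)
  then have W: "vsubspace n (vspan n ws)" and w: "w \<in> carrier_vec n"
    by (auto intro!: vsubspace_vspan)
  have "x \<in> vspan n (w # ws)" if "x \<in> vspan n ws" for x
  proof -
    have "x \<in> carrier_vec n" using that vsubspace_subset[OF W] by auto
    then have "x = 0 \<cdot>\<^sub>v w + x" using w by auto
    with that show ?thesis unfolding vspan.simps by (intro image_eqI[of _ _ "(0, x)"]) auto
  qed
  moreover have "w \<in> vspan n (w # ws)"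
    using w vsubspace_zero[OF W] unfolding vspan.simps by (intro image_eqI[of _ _ "(1, 0\<^sub>v n)"]) auto
  ultimately show ?case using Cons by auto
qed auto

lemma finite_vspan [simp]: "finite (vspan n (ws :: 'a::{field,finite} vec list))"
  by (induction ws) auto

lemma card_vspan_le: "card (vspan n (ws :: 'a::{field,finite} vec list)) \<le> CARD('a) ^ length ws"
proof (induction ws)
  case (Cons w ws)
  have "card (vspan n (w # ws)) \<le> card ((UNIV :: 'a set) \<times> vspan n ws)"
    unfolding vspan.simps by (rule card_image_le) auto
  also have "\<dots> \<le> CARD('a) * CARD('a) ^ length ws"
    using Cons by (simp add: card_cartesian_product)
  finally show ?case by simp
qed auto

lemma smult_add_eqD:
  fixes w :: "'a::field vec"
  assumes W: "vsubspace n W" and w: "w \<in> carrier_vec n" "w \<notin> W"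
    and x: "x \<in> W" and y: "y \<in> W" and eq: "k \<cdot>\<^sub>v w + x = l \<cdot>\<^sub>v w + y"
  shows "k = l" "x = y"
proof -
  have c: "x \<in> carrier_vec n" "y \<in> carrier_vec n" using x y vsubspace_subset[OF W] by auto
  have i: "k * w $ i + x $ i = l * w $ i + y $ i" if "i < n" for i
    using arg_cong[OF eq, of "\<lambda>v. v $ i"] that c w by auto
  show "k = l"
  proof (rule ccontr)
    assume "k \<noteq> l"
    have "w = (1 / (k - l)) \<cdot>\<^sub>v (y - x)"
      using \<open>k \<noteq> l\<close> c w i by (intro eq_vecI) (auto simp: field_simps)
    then show False using w vsubspace_smult[OF W vsubspace_diff[OF W y x]] by metis
  qed
  then show "x = y" using c w i by (intro eq_vecI) auto
qed

text \<open>By \<open>smult_add_eqD\<close>, the scalar and the tail part of an element of the span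
  are unique, so every new head multiplies the size of the span by \<open>CARD('a)\<close>.\<close>

lemma card_vspan_vindep:
  fixes ws :: "'a::{field,finite} vec list"
  assumes "set ws \<subseteq> carrier_vec n" "vindep n ws"
  shows "card (vspan n ws) = CARD('a) ^ length ws"
  using assms
proof (induction ws)
  case (Cons w ws)
  then have W: "vsubspace n (vspan n ws)" by (auto intro!: vsubspace_vspan)
  have "inj_on (\<lambda>(k, y). k \<cdot>\<^sub>v w + y) (UNIV \<times> vspan n ws)"
    using smult_add_eqD[OF W, of w] Cons.prems unfolding inj_on_def by auto
  then have "card (vspan n (w # ws)) = card ((UNIV :: 'a set) \<times> vspan n ws)"
    by (simp add: card_image)
  then show ?case using Cons by (simp add: card_cartesian_product)
qed auto

lemma vspan_appendE:
  assumes "x \<in> vspan n (ps @ qs)" "set ps \<subseteq> carrier_vec n" "set qs \<subseteq> carrier_vec n"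
  obtains y z where "y \<in> vspan n ps" "z \<in> vspan n qs" "x = y + z"
proof -
  have "\<exists>y\<in>vspan n ps. \<exists>z\<in>vspan n qs. x = y + z"
    using assms(1,2)
  proof (induction ps arbitrary: x)
    case Nil
    then have "x \<in> carrier_vec n" using vspan_in_carrier[OF assms(3)] by auto
    with Nil show ?case by (intro bexI[of _ "0\<^sub>v n"] bexI[of _ x]) auto
  next
    case (Cons p ps)
    then obtain k x' where x: "x = k \<cdot>\<^sub>v p + x'" "x' \<in> vspan n (ps @ qs)" by auto
    with Cons obtain y z where yz: "y \<in> vspan n ps" "z \<in> vspan n qs" "x' = y + z" by force
    then have "y \<in> carrier_vec n" "z \<in> carrier_vec n" 
      using vspan_in_carrier assms(3) Cons.prems by auto
    then have "x = (k \<cdot>\<^sub>v p + y) + z" using x yz Cons.prems by (intro eq_vecI) auto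
    then show ?case using yz by force
  qed
  with that show ?thesis by blast
qed

text \<open>If a head \<open>p\<close> lay in the span of \<open>ps @ qs\<close>, say
  \<open>p = y + z\<close>, then \<open>z = p - y\<close> would lie in both spans and hence vanish.
  This would put \<open>p\<close> into the span of \<open>ps\<close>.\<close>

lemma vindep_append:
  assumes "set ps \<subseteq> carrier_vec n" "set qs \<subseteq> carrier_vec n" "vindep n ps" "vindep n qs"
    "vspan n ps \<inter> vspan n qs \<subseteq> {0\<^sub>v n}"
  shows "vindep n (ps @ qs)"
  using assms(1,3,5)
proof (induction ps)
  case Nil
  then show ?case using assms by auto
next
  case (Cons p ps)
  have P: "vsubspace n (vspan n (p # ps))" using Cons.prems by (intro vsubspace_vspan) auto
  have sub: "vspan n ps \<subseteq> vspan n (p # ps)"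
    using vspan_superset[OF Cons.prems(1)] P by (intro vspan_subset) auto
  have "p \<notin> vspan n (ps @ qs)"
  proof
    assume "p \<in> vspan n (ps @ qs)"
    then obtain y z where yz: "y \<in> vspan n ps" "z \<in> vspan n qs" "p = y + z"
      using Cons.prems assms(2) by (elim vspan_appendE) auto
    have c: "y \<in> carrier_vec n" "z \<in> carrier_vec n"
      using yz vspan_in_carrier assms(2) Cons.prems by auto
    then have "z = p - y" using yz by (intro eq_vecI) auto
    moreover have "p - y \<in> vspan n (p # ps)"
      using vspan_superset[OF Cons.prems(1)] sub yz by (intro vsubspace_diff[OF P]) auto
    ultimately have "z = 0\<^sub>v n" using yz Cons.prems(3) by auto
    then have "p = y" using yz c by simp
    then show False using yz Cons.prems by auto
  qed
  moreover have "vspan n ps \<inter> vspan n qs \<subseteq> {0\<^sub>v n}" using Cons.prems(3) sub by blast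
  ultimately show ?case using Cons.IH Cons.prems(1,2) by simp
qed

lemma vspan_map:
  assumes u: "u \<in> carrier_mat m n" and "set ws \<subseteq> carrier_vec n"
  shows "vspan m (map ((*\<^sub>v) u) ws) = (*\<^sub>v) u ` vspan n ws"
  using assms(2)
proof (induction ws)
  case Nil
  then show ?case using u by auto
next
  case (Cons w ws)
  then have w: "w \<in> carrier_vec n" and c: "\<And>y. y \<in> vspan n ws \<Longrightarrow> y \<in> carrier_vec n"
    using vspan_in_carrier[of ws n] by auto
  have "u *\<^sub>v (k \<cdot>\<^sub>v w + y) = k \<cdot>\<^sub>v (u *\<^sub>v w) + u *\<^sub>v y" if "y \<in> vspan n ws" for k y
    using c[OF that] w u by (simp add: mult_add_distrib_mat_vec[OF u] mult_mat_vec[OF u])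
  then have "(*\<^sub>v) u ` vspan n (w # ws)
      = (\<lambda>(k, y). k \<cdot>\<^sub>v (u *\<^sub>v w) + u *\<^sub>v y) ` (UNIV \<times> vspan n ws)"
    unfolding vspan.simps image_image by (intro image_cong) auto
  also have "\<dots> = (\<lambda>(k, y). k \<cdot>\<^sub>v (u *\<^sub>v w) + y) ` (\<lambda>(k, y). (k, u *\<^sub>v y)) ` (UNIV \<times> vspan n ws)"
    unfolding image_image by (intro image_cong) auto
  also have "(\<lambda>(k, y). (k, u *\<^sub>v y)) ` ((UNIV :: 'a set) \<times> vspan n ws)
      = UNIV \<times> (*\<^sub>v) u ` vspan n ws" by auto
  finally show ?case using Cons by simp
qed

text \<open>Basis extension by counting: fewer than \<open>n\<close> vectors span fewer than
  \<open>CARD('a) ^ n\<close> vectors, so some vector is left outside. New vectors are prepended,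
  which is why \<open>rs\<close> precedes \<open>ws\<close>.\<close>

lemma vindep_extend:
  fixes ws :: "'a::{field,finite} vec list"
  assumes "set ws \<subseteq> carrier_vec n" "vindep n ws" "length ws \<le> n"
  shows "\<exists>rs. set rs \<subseteq> carrier_vec n \<and> length rs = n - length ws \<and> vindep n (rs @ ws)"
  using assms
proof (induction "n - length ws" arbitrary: ws)
  case 0
  then show ?case by (intro exI[of _ "[]"]) auto
next
  case (Suc d)
  have "card (vspan n ws) < card (carrier_vec n :: 'a vec set)"
    unfolding card_vspan_vindep[OF Suc.prems(1,2)] card_carrier_vec
    using Suc.hyps(2) two_le_card_field[where 'a = 'a] by (intro power_strict_increasing) auto
  then obtain r where r: "r \<in> carrier_vec n" "r \<notin> vspan n ws"
    by (metis card_mono finite_vspan not_le subsetI)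
  have "d = n - length (r # ws)" "length (r # ws) \<le> n" using Suc.hyps(2) by auto
  moreover have "set (r # ws) \<subseteq> carrier_vec n" "vindep n (r # ws)" using Suc.prems r by auto
  ultimately obtain rs where "set rs \<subseteq> carrier_vec n" "length rs = n - length (r # ws)"
    "vindep n (rs @ r # ws)"
    using Suc.hyps(1)[of "r # ws"] by blast
  then show ?case using r Suc.hyps(2) by (intro exI[of _ "rs @ [r]"]) auto
qed

lemma vspan_eq_carrier:
  fixes ws :: "'a::{field,finite} vec list"
  assumes "set ws \<subseteq> carrier_vec n" "vindep n ws" "length ws = n"
  shows "vspan n ws = carrier_vec n"
  using assms by (intro card_subset_eq vspan_in_carrier) (auto simp: card_vspan_vindep card_carrier_vec)

section \<open>Matrices determined by their values on a basis\<close>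

lemma eq_mat_if_mult_vec_eq:
  fixes A B :: "'a::semiring_1 mat"
  assumes A: "A \<in> carrier_mat m n" and B: "B \<in> carrier_mat m n"
    and eq: "\<And>x. x \<in> carrier_vec n \<Longrightarrow> A *\<^sub>v x = B *\<^sub>v x"
  shows "A = B"
proof (rule eq_matI)
  fix i j assume "i < dim_row B" "j < dim_col B"
  then show "A $$ (i, j) = B $$ (i, j)"
    using arg_cong[OF eq[of "unit_vec n j"], of "\<lambda>v. v $ i"] A B
    by (auto simp: scalar_prod_right_unit)
qed (use A B in auto)

lemma eq_mat_if_eq_on_spanning:
  assumes A: "A \<in> carrier_mat m n" and B: "B \<in> carrier_mat m n"
    and ws: "set ws \<subseteq> carrier_vec n" "vspan n ws = carrier_vec n"
    and eq: "\<And>x. x \<in> set ws \<Longrightarrow> A *\<^sub>v x = B *\<^sub>v x"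
  shows "A = B"
proof -
  have "vsubspace n {x \<in> carrier_vec n. A *\<^sub>v x = B *\<^sub>v x}"
    using A B unfolding vsubspace_def
    by (auto simp: mult_add_distrib_mat_vec[OF A] mult_add_distrib_mat_vec[OF B]
        mult_mat_vec[OF A] mult_mat_vec[OF B])
  from vspan_subset[OF this, of ws] eq ws have "carrier_vec n \<subseteq> {x. A *\<^sub>v x = B *\<^sub>v x}" by auto
  then show ?thesis by (intro eq_mat_if_mult_vec_eq[OF A B]) auto
qed

lemma card_lists_carrier_vec:
  "card {ws :: 'a::finite vec list. set ws \<subseteq> carrier_vec n \<and> length ws = m} = CARD('a) ^ (n * m)"
  by (simp add: card_lists_length_eq card_carrier_vec power_mult)

lemma bij_betw_mat_of_cols:
  "bij_betw (mat_of_cols n) {ws :: 'a vec list. set ws \<subseteq> carrier_vec n \<and> length ws = m} (carrier_mat n m)"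
proof (rule bij_betw_byWitness[where f' = cols])
  show "\<forall>ws\<in>{ws. set ws \<subseteq> carrier_vec n \<and> length ws = m}. cols (mat_of_cols n ws) = ws" by auto
  show "\<forall>A\<in>carrier_mat n m. mat_of_cols n (cols A) = A" by auto
  show "mat_of_cols n ` {ws. set ws \<subseteq> carrier_vec n \<and> length ws = m} \<subseteq> carrier_mat n m" by auto
  show "cols ` carrier_mat n m \<subseteq> {ws. set ws \<subseteq> carrier_vec n \<and> length ws = m}"
    by (auto simp: cols_def)
qed

lemma card_carrier_mat:
  "card (carrier_mat n m :: 'a::finite mat set) = CARD('a) ^ (n * m)"
  and finite_carrier_mat: "finite (carrier_mat n m :: 'a::finite mat set)"
proof -
  note bij = bij_betw_mat_of_cols[where 'a = 'a, of n m]
  show "card (carrier_mat n m :: 'a mat set) = CARD('a) ^ (n * m)"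
    using bij_betw_same_card[OF bij] by (simp add: card_lists_carrier_vec)
  show "finite (carrier_mat n m :: 'a mat set)"
    using bij_betw_finite[OF bij] finite_lists_length_eq[of "carrier_vec n :: 'a vec set" m] by simp
qed

text \<open>Evaluation on the spanning list is injective on matrices, and there are as many matrices
  as lists of images. Hence evaluation is onto.\<close>

lemma mat_of_basis_images:
  fixes ss ts :: "'a::{field,finite} vec list"
  assumes "set ss \<subseteq> carrier_vec n" "vspan n ss = carrier_vec n" "length ss = n"
    and "set ts \<subseteq> carrier_vec m" "length ts = n"
  shows "\<exists>u\<in>carrier_mat m n. map ((*\<^sub>v) u) ss = ts"
proof -
  let ?f = "\<lambda>u. map ((*\<^sub>v) u) ss" and ?L = "{ws :: 'a vec list. set ws \<subseteq> carrier_vec m \<and> length ws = n}"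
  have "inj_on ?f (carrier_mat m n)"
    using assms by (intro inj_onI eq_mat_if_eq_on_spanning[of _ m n _ ss]) auto
  then have "card (?f ` carrier_mat m n) = card ?L"
    by (simp add: card_image card_carrier_mat card_lists_carrier_vec)
  moreover have "u *\<^sub>v x \<in> carrier_vec m" if "u \<in> carrier_mat m n" "x \<in> set ss" for u x
    using that assms(1) by (intro mult_mat_vec_carrier) auto
  then have "?f ` carrier_mat m n \<subseteq> ?L" using assms(3) by auto
  ultimately have "?f ` carrier_mat m n = ?L"
    by (intro card_subset_eq) (auto intro: finite_lists_length_eq)
  then have "ts \<in> ?f ` carrier_mat m n" using assms by simp
  then show ?thesis by auto
qed

section \<open>Counting along fibres and intersecting subspaces\<close>

lemma card_le_fiber_bound:
  assumes "finite A" "f ` A \<subseteq> B" "finite B" "\<And>y. y \<in> B \<Longrightarrow> card {x \<in> A. f x = y} \<le> k"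
  shows "card A \<le> card B * k"
proof -
  have "card A = (\<Sum>y\<in>B. card {x \<in> A. f x = y})"
    using card_eq_sum[of A] sum.group[OF assms(1,3,2), of "\<lambda>_. 1::nat"] by simp
  also have "\<dots> \<le> card B * k" using sum_bounded_above[of B _ k] assms(4) by auto
  finally show ?thesis .
qed

lemma diff_vec_right_cancel:
  fixes v w :: "'a::ab_group_add vec"
  assumes "v \<in> carrier_vec n" "v' \<in> carrier_vec n" "w \<in> carrier_vec n" "v - w = v' - w"
  shows "v = v'"
proof (rule eq_vecI)
  fix i assume "i < dim_vec v'"
  then show "v $ i = v' $ i" using arg_cong[OF assms(4), of "\<lambda>x. x $ i"] assms(1-3) by auto
qed (use assms in auto)

text \<open>Two points of a fibre of \<open>(x, y) \<mapsto> x - y\<close> differ by a pair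
  \<open>(d, d)\<close> with \<open>d\<close> in both subspaces, so no fibre is larger than the
  intersection. This is the dimension formula as an inequality between cardinalities.\<close>

lemma card_mult_vsubspaces_le:
  fixes X Y :: "'a::{field,finite} vec set"
  assumes X: "vsubspace n X" and Y: "vsubspace n Y"
  shows "card X * card Y \<le> CARD('a) ^ n * card (X \<inter> Y)"
proof -
  have c: "\<And>x. x \<in> X \<Longrightarrow> x \<in> carrier_vec n" "\<And>x. x \<in> Y \<Longrightarrow> x \<in> carrier_vec n"
    using vsubspace_subset X Y by auto
  have "card (X \<times> Y) \<le> card (carrier_vec n :: 'a vec set) * card (X \<inter> Y)"
  proof (rule card_le_fiber_bound[where f = "\<lambda>(x, y). x - y"])
    show "finite (X \<times> Y)" using X Y finite_vsubspace by blast
    show "(\<lambda>(x, y). x - y) ` (X \<times> Y) \<subseteq> carrier_vec n" using c by auto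
    fix z :: "'a vec"
    let ?F = "{p \<in> X \<times> Y. (case p of (x, y) \<Rightarrow> x - y) = z}"
    show "card ?F \<le> card (X \<inter> Y)"
    proof (cases "?F = {}")
      case True
      then show ?thesis by (metis card.empty le0)
    next
      case False
      then obtain x0 y0 where 0: "x0 \<in> X" "y0 \<in> Y" "x0 - y0 = z" by auto
      have eq: "x - x0 = y - y0" if "x \<in> X" "y \<in> Y" "x - y = z" for x y
      proof (rule eq_vecI)
        fix i assume "i < dim_vec (y - y0)"
        then have i: "i < n" using c(2)[OF 0(2)] by simp
        have "(x - y) $ i = (x0 - y0) $ i" using 0 that by simp
        then show "(x - x0) $ i = (y - y0) $ i"
          using i c(1)[OF that(1)] c(2)[OF that(2)] c(1)[OF 0(1)] c(2)[OF 0(2)] by (simp add: algebra_simps)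
      qed (use c(1)[OF 0(1)] c(2)[OF 0(2)] in simp)
      show ?thesis
      proof (rule card_inj_on_le[where f = "\<lambda>(x, y). x - x0"])
        show "finite (X \<inter> Y)" using X finite_vsubspace by blast
        show "(\<lambda>(x, y). x - x0) ` ?F \<subseteq> X \<inter> Y"
        proof (rule image_subsetI)
          fix p assume "p \<in> ?F"
          then obtain x y where p: "p = (x, y)" and *: "x \<in> X" "y \<in> Y" "x - y = z" by auto
          have "x - x0 \<in> X" by (rule vsubspace_diff[OF X *(1) 0(1)])
          moreover have "x - x0 \<in> Y" unfolding eq[OF *] by (rule vsubspace_diff[OF Y *(2) 0(2)])
          ultimately show "(case p of (x, y) \<Rightarrow> x - x0) \<in> X \<inter> Y"
            using p by simp
        qed
        show "inj_on (\<lambda>(x, y). x - x0) ?F"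
        proof (rule inj_onI)
          fix p p' assume F: "p \<in> ?F" "p' \<in> ?F"
            and eq0: "(case p of (x, y) \<Rightarrow> x - x0) = (case p' of (x, y) \<Rightarrow> x - x0)"
          obtain x y x' y' where p: "p = (x, y)" "p' = (x', y')" by (metis surj_pair)
          with F have *: "x \<in> X" "y \<in> Y" "x - y = z" "x' \<in> X" "y' \<in> Y" "x' - y' = z"
            by simp_all
          have "x - x0 = x' - x0" using eq0 p by simp
          have "y - y0 = y' - y0" using eq[OF *(1-3)] eq[OF *(4-6)] \<open>x - x0 = x' - x0\<close> by simp
          have "x = x'" by (rule diff_vec_right_cancel[OF c(1)[OF *(1)] c(1)[OF *(4)] c(1)[OF 0(1)]]) fact
          moreover have "y = y'" by (rule diff_vec_right_cancel[OF c(2)[OF *(2)] c(2)[OF *(5)] c(2)[OF 0(2)]]) fact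
          ultimately show "p = p'"
            using p by simp
        qed
      qed
    qed
  qed simp
  then show ?thesis by (simp add: card_cartesian_product card_carrier_vec)
qed

section \<open>Counting lists chosen step by step\<close>

text \<open>The bound is uniform in \<open>m\<close>, \<open>d\<close> and \<open>q\<close>, so a
  list chosen step by step loses only a constant factor. The value 1/16 is \<open>(1 - t/2)\<close>
  squared at the extreme case \<open>t = 3/2\<close>.\<close>

lemma prod_one_minus_ge:
  fixes t q :: real
  assumes "0 \<le> t" "t \<le> 3/2" "2 \<le> q" "m \<le> d"
  shows "1/16 \<le> (\<Prod>i<m. 1 - t / q ^ (d - i))"
proof -
  \<comment> \<open>The surplus \<open>t / 2 ^ Suc k\<close> makes the induction close. It halves at
    each step, and with \<open>s\<close> the new surplus, \<open>(1 - t/2 + 2 * s) * (1 - s)\<close>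
    is at least \<open>1 - t/2 + s\<close> because the first factor is at most 1.\<close>
  have *: "(1 - t/2) * (1 - t/2 + t / 2 ^ Suc k) \<le> (\<Prod>i<Suc k. 1 - t / 2 ^ Suc i)" for k
  proof (induction k)
    case (Suc k)
    define s where "s = t / 2 ^ Suc (Suc k)"
    have s: "0 \<le> s" "2 * s = t / 2 ^ Suc k" using assms by (auto simp: s_def)
    have "t / 2 ^ Suc k \<le> t / 2" using assms(1) by (intro divide_left_mono) auto
    then have le: "2 * s \<le> t / 2" using s by simp
    have "s * (1 - t/2 + 2 * s) \<le> s * 1" using s le by (intro mult_left_mono) auto
    then have "1 - t/2 + s \<le> (1 - t/2 + 2 * s) * (1 - s)"
      by (simp add: algebra_simps)
    then have "(1 - t/2) * (1 - t/2 + s) \<le> ((1 - t/2) * (1 - t/2 + 2 * s)) * (1 - s)"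
      using assms by (simp only: mult.assoc) (intro mult_left_mono, auto)
    also have "\<dots> \<le> (\<Prod>i<Suc k. 1 - t / 2 ^ Suc i) * (1 - s)"
      using Suc s le assms by (intro mult_right_mono) auto
    finally show ?case by (simp add: s_def)
  qed auto
  have "1/16 \<le> (1 - t/2) * (1 - t/2)" using mult_mono[of "1/4" "1 - t/2" "1/4" "1 - t/2"] assms by simp
  also have "\<dots> \<le> (\<Prod>i<m. 1 - t / 2 ^ Suc i)"
  proof (cases m)
    case 0
    then show ?thesis using mult_mono[of "1 - t/2" 1 "1 - t/2" 1] assms by simp
  next
    case (Suc k)
    have "(1 - t/2) * (1 - t/2) \<le> (1 - t/2) * (1 - t/2 + t / 2 ^ Suc k)"
      using assms by (intro mult_left_mono) auto
    with * [of k] Suc show ?thesis by simp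
  qed
  \<comment> \<open>Reversing the order of the factors aligns them with \<open>d - i\<close>; then
    \<open>m - i \<le> d - i\<close> and \<open>2 \<le> q\<close> allow a comparison factor by
    factor.\<close>
  also have "\<dots> = (\<Prod>i<m. 1 - t / 2 ^ (m - i))"
    using prod.nat_diff_reindex[of "\<lambda>j. 1 - t / 2 ^ Suc j" m] by (simp add: Suc_diff_Suc)
  also have "\<dots> \<le> (\<Prod>i<m. 1 - t / q ^ (d - i))"
  proof (intro prod_mono conjI)
    fix i assume i: "i \<in> {..<m}"
    have "(2::real) ^ 1 \<le> 2 ^ (m - i)" using i by (intro power_increasing) auto
    then have "t / 2 ^ (m - i) \<le> (3/2) / 2" using assms by (intro frac_le) auto
    then show "0 \<le> 1 - t / 2 ^ (m - i)" by linarith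
    have "(2::real) ^ (m - i) \<le> 2 ^ (d - i)" using assms by (intro power_increasing) auto
    also have "\<dots> \<le> q ^ (d - i)" using assms by (intro power_mono) auto
    finally show "1 - t / 2 ^ (m - i) \<le> 1 - t / q ^ (d - i)"
      using assms by (simp add: divide_left_mono)
  qed
  finally show ?thesis .
qed

lemma card_Sigma_ge:
  assumes "finite A" "\<And>x. x \<in> A \<Longrightarrow> finite (B x)" "\<And>x. x \<in> A \<Longrightarrow> k \<le> real (card (B x))"
  shows "real (card A) * k \<le> real (card (Sigma A B))"
proof -
  have "real (card A) * k = (\<Sum>x\<in>A. k)" by simp
  also have "\<dots> \<le> (\<Sum>x\<in>A. real (card (B x)))" using assms(3) by (rule sum_mono)
  finally show ?thesis using assms(1,2) by (simp add: card_SigmaI)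
qed

text \<open>Lists grow at the head, and each good list of length \<open>i\<close> has at least
  \<open>f i\<close> good extensions. The parallel list \<open>rs\<close> is carried along because
  the condition on a new entry may depend on the entry of \<open>rs\<close> that it is matched
  with.\<close>

lemma card_lists_stepwise_ge:
  fixes P :: "'c list \<Rightarrow> 'b list \<Rightarrow> bool" and f :: "nat \<Rightarrow> real"
  assumes "finite V" "P [] []" "set rs \<subseteq> U" "length rs \<le> m" "\<And>i. i < m \<Longrightarrow> 0 \<le> f i"
    and step: "\<And>r rs xs. r \<in> U \<Longrightarrow> set rs \<subseteq> U \<Longrightarrow> set xs \<subseteq> V \<Longrightarrow> length xs = length rs \<Longrightarrow>
      length rs < m \<Longrightarrow> P rs xs \<Longrightarrow> f (length rs) \<le> real (card {x \<in> V. P (r # rs) (x # xs)})"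
  shows "(\<Prod>i<length rs. f i) \<le> real (card {xs. set xs \<subseteq> V \<and> length xs = length rs \<and> P rs xs})"
  using assms(3,4)
proof (induction rs)
  case Nil
  have "{xs. set xs \<subseteq> V \<and> length xs = length ([] :: 'c list) \<and> P [] xs} = {[]}" using assms(2) by auto
  then show ?case by (simp only: list.size) simp
next
  case (Cons r rs)
  define S where "S = (\<lambda>rs. {xs. set xs \<subseteq> V \<and> length xs = length rs \<and> P rs xs})"
  have fin: "finite (S rs)" for rs
    using finite_lists_length_eq[OF assms(1), of "length rs"] by (rule rev_finite_subset) (auto simp: S_def)
  have "(\<Prod>i<length (r # rs). f i) \<le> real (card (S rs)) * f (length rs)"
    using Cons assms(5) by (auto simp: S_def intro!: mult_right_mono)
  also have "\<dots> \<le> real (card (SIGMA xs : S rs. {x \<in> V. P (r # rs) (x # xs)}))"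
    using Cons.prems fin assms(1) by (intro card_Sigma_ge step) (auto simp: S_def)
  also have "card (SIGMA xs : S rs. {x \<in> V. P (r # rs) (x # xs)}) \<le> card (S (r # rs))"
    by (rule card_inj_on_le[where f = "\<lambda>(xs, x). x # xs", OF _ _ fin]) (auto simp: inj_on_def S_def)
  finally show ?case by (simp add: S_def)
qed

text \<open>The case without a parallel list, obtained by running along a list of units.\<close>

corollary card_lists_stepwise_ge':
  fixes P :: "'b list \<Rightarrow> bool" and f :: "nat \<Rightarrow> real"
  assumes "finite V" "P []" "\<And>i. i < m \<Longrightarrow> 0 \<le> f i"
    and "\<And>xs. set xs \<subseteq> V \<Longrightarrow> length xs < m \<Longrightarrow> P xs \<Longrightarrow>
      f (length xs) \<le> real (card {x \<in> V. P (x # xs)})"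
  shows "(\<Prod>i<m. f i) \<le> real (card {xs. set xs \<subseteq> V \<and> length xs = m \<and> P xs})"
proof -
  have "(\<Prod>i<length (replicate m ()). f i) \<le>
      real (card {xs. set xs \<subseteq> V \<and> length xs = length (replicate m ()) \<and> P xs})"
    by (rule card_lists_stepwise_ge[where U = UNIV and m = m]) (use assms in \<open>auto, metis\<close>)
  then show ?thesis by simp
qed

text \<open>After \<open>i\<close> independent vectors, exactly \<open>q ^ d - q ^ i\<close> vectors
  of \<open>W\<close> are allowed, a proportion \<open>1 - 1 / q ^ (d - i)\<close>. The product of
  these proportions is bounded by \<open>prod_one_minus_ge\<close> with
  \<open>t = 1\<close>.\<close>

lemma card_vindep_lists_ge:
  fixes W :: "'a::{field,finite} vec set"
  assumes W: "vsubspace n W" and card: "card W = CARD('a) ^ d" and "m \<le> d"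
  shows "real CARD('a) ^ (d * m) / 16 \<le>
    real (card {ws. set ws \<subseteq> W \<and> length ws = m \<and> vindep n ws})"
proof -
  define q where "q = real CARD('a)"
  have q: "2 \<le> q" using two_le_card_field[where 'a = 'a] by (simp add: q_def)
  define f where "f = (\<lambda>i. q ^ d * (1 - 1 / q ^ (d - i)))"
  have "q ^ (d * m) / 16 = (q ^ d) ^ m * (1/16)" by (simp add: power_mult)
  also have "\<dots> \<le> (q ^ d) ^ m * (\<Prod>i<m. 1 - 1 / q ^ (d - i))"
    using q assms(3) by (intro mult_left_mono prod_one_minus_ge) auto
  also have "\<dots> = (\<Prod>i<m. f i)" by (simp add: f_def prod.distrib)
  also have "\<dots> \<le> real (card {ws. set ws \<subseteq> W \<and> length ws = m \<and> vindep n ws})"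
  proof (rule card_lists_stepwise_ge')
    show "finite W" using finite_vsubspace[OF W] .
    show "0 \<le> f i" for i using q by (simp add: f_def)
    fix ws assume ws: "set ws \<subseteq> W" "length ws < m" "vindep n ws"
    have "f (length ws) = q ^ d - q ^ length ws"
      using q ws assms(3) by (simp add: f_def algebra_simps power_diff)
    also have "\<dots> = real (card W) - real (card (vspan n ws))"
      using ws vsubspace_subset[OF W] by (simp add: card card_vspan_vindep q_def)
    also have "\<dots> \<le> real (card (W - vspan n ws))"
      using diff_card_le_card_Diff[of "vspan n ws" W] by simp
    also have "W - vspan n ws = {w \<in> W. vindep n (w # ws)}" using ws by auto
    finally show "f (length ws) \<le> real (card {w \<in> W. vindep n (w # ws)})" .
  qed simp
  finally show ?thesis by (simp add: q_def)
qed

section \<open>Invertible matrices and kernel dimensions by means of bases\<close>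

lemma GL_of_basis_images:
  fixes ss ts :: "'a::{field,finite} vec list"
  assumes ss: "set ss \<subseteq> carrier_vec n" "vindep n ss" "length ss = n"
    and ts: "set ts \<subseteq> carrier_vec n" "vindep n ts" "length ts = n"
  obtains u where "u \<in> GL n" "map ((*\<^sub>v) u) ss = ts"
proof -
  note span = vspan_eq_carrier[OF ss] vspan_eq_carrier[OF ts]
  obtain u where u: "u \<in> carrier_mat n n" "map ((*\<^sub>v) u) ss = ts"
    using mat_of_basis_images[OF ss(1) span(1) ss(3) ts(1,3)] by auto
  obtain v where v: "v \<in> carrier_mat n n" "map ((*\<^sub>v) v) ts = ss"
    using mat_of_basis_images[OF ts(1) span(2) ts(3) ss(1,3)] by auto
  have "map ((*\<^sub>v) v \<circ> (*\<^sub>v) u) ss = map id ss" using u v by (simp flip: map_map)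
  then have "v *\<^sub>v (u *\<^sub>v x) = x" if "x \<in> set ss" for x using that unfolding map_eq_conv by simp
  then have "v * u = 1\<^sub>m n"
    using u v ss by (intro eq_mat_if_eq_on_spanning[of _ n n _ ss]) (auto simp: span subset_iff)
  have "map ((*\<^sub>v) u \<circ> (*\<^sub>v) v) ts = map id ts" using u v by (simp flip: map_map)
  then have "u *\<^sub>v (v *\<^sub>v x) = x" if "x \<in> set ts" for x using that unfolding map_eq_conv by simp
  then have "u * v = 1\<^sub>m n"
    using u v ts by (intro eq_mat_if_eq_on_spanning[of _ n n _ ts]) (auto simp: span subset_iff)
  with \<open>v * u = 1\<^sub>m n\<close> u v have "u \<in> GL n"
    by (auto simp: GL_def invertible_mat_def inverts_mat_def)
  with u that show ?thesis by blast
qed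

lemma GL_inverse:
  assumes "u \<in> GL n"
  obtains v where "v \<in> carrier_mat n n" "u * v = 1\<^sub>m n" "v * u = 1\<^sub>m n"
proof -
  obtain v where v: "u * v = 1\<^sub>m n" "v * u = 1\<^sub>m (dim_row v)" and u: "u \<in> carrier_mat n n"
    using assms by (auto simp: GL_def invertible_mat_def inverts_mat_def)
  have "dim_col v = n" using arg_cong[OF v(1), of dim_col] by simp
  moreover have "dim_row v = n" using arg_cong[OF v(2), of dim_col] u by simp
  ultimately show ?thesis using v that[of v] by auto
qed

lemma card_GL_le: "card (GL g :: 'a::{field,finite} mat set) \<le> CARD('a) ^ (g * g)"
  using card_mono[OF finite_carrier_mat, of "GL g" g g] by (auto simp: card_carrier_mat GL_def)

lemma finite_GL [simp]: "finite (GL g :: 'a::{field,finite} mat set)"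
  using finite_carrier_mat[of g g] by (rule rev_finite_subset) (auto simp: GL_def)

text \<open>Every independent list of \<open>g\<close> vectors is the image of one fixed basis under
  an element of \<open>GL g\<close>. With \<open>card_GL_le\<close> this lets
  \<open>q ^ (g * g)\<close> stand for the order of the group up to a factor 16, uniformly in
  \<open>g\<close>.\<close>

lemma card_GL_ge: "real CARD('a) ^ (g * g) / 16 \<le> real (card (GL g :: 'a::{field,finite} mat set))"
proof -
  obtain ss :: "'a vec list" where ss: "set ss \<subseteq> carrier_vec g" "vindep g ss" "length ss = g"
    using vindep_extend[of "[]" g] by auto
  have "{ts. set ts \<subseteq> carrier_vec g \<and> length ts = g \<and> vindep g ts} \<subseteq> (\<lambda>u. map ((*\<^sub>v) u) ss) ` GL g"
    using GL_of_basis_images[OF ss] by (auto simp: image_iff) metis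
  then have "card {ts :: 'a vec list. set ts \<subseteq> carrier_vec g \<and> length ts = g \<and> vindep g ts} \<le> card (GL g :: 'a mat set)"
    by (rule surj_card_le[rotated]) simp
  moreover have "real CARD('a) ^ (g * g) / 16
      \<le> real (card {ts :: 'a vec list. set ts \<subseteq> carrier_vec g \<and> length ts = g \<and> vindep g ts})"
    by (rule card_vindep_lists_ge[OF vsubspace_carrier]) (auto simp: card_carrier_vec)
  ultimately show ?thesis by linarith
qed

lemma mem_mat_kernel_diff:
  assumes "A \<in> carrier_mat m n" "B \<in> carrier_mat m n"
  shows "x \<in> mat_kernel (A - B) \<longleftrightarrow> x \<in> carrier_vec n \<and> A *\<^sub>v x = B *\<^sub>v x"
proof -
  have "A *\<^sub>v x - B *\<^sub>v x = 0\<^sub>v m \<longleftrightarrow> A *\<^sub>v x = B *\<^sub>v x" if x: "x \<in> carrier_vec n"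
  proof
    assume eq: "A *\<^sub>v x - B *\<^sub>v x = 0\<^sub>v m"
    show "A *\<^sub>v x = B *\<^sub>v x"
    proof (rule eq_vecI)
      fix i assume "i < dim_vec (B *\<^sub>v x)"
      then show "(A *\<^sub>v x) $ i = (B *\<^sub>v x) $ i"
        using arg_cong[OF eq, of "\<lambda>v. v $ i"] assms by simp
    qed (use assms in auto)
  qed (use assms in auto)
  then show ?thesis
    unfolding mat_kernel[OF minus_carrier_mat[OF assms(2)]]
    by (auto simp: minus_mult_distrib_mat_vec[OF assms])
qed

lemma vindep_map:
  fixes u :: "'a::{field,finite} mat"
  assumes u: "u \<in> carrier_mat m n" "mat_kernel u \<subseteq> {0\<^sub>v n}" and "set ws \<subseteq> carrier_vec n" "vindep n ws"
  shows "vindep m (map ((*\<^sub>v) u) ws)"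
  using assms(3,4)
proof (induction ws)
  case (Cons w ws)
  have "u *\<^sub>v w \<noteq> u *\<^sub>v y" if "y \<in> vspan n ws" for y
  proof
    assume eq: "u *\<^sub>v w = u *\<^sub>v y"
    have c: "w \<in> carrier_vec n" "y \<in> carrier_vec n" using that Cons.prems vspan_in_carrier[of ws n] by auto
    then have "w - y \<in> mat_kernel u"
      using u eq by (intro mat_kernelI[OF u(1)]) (auto simp: mult_minus_distrib_mat_vec[OF u(1)])
    then have 0: "w - y = 0\<^sub>v n" using u by auto
    have "w = y"
    proof (rule eq_vecI)
      fix i assume "i < dim_vec y"
      then show "w $ i = y $ i" using arg_cong[OF 0, of "\<lambda>v. v $ i"] c by simp
    qed (use c in auto)
    then show False using that Cons.prems by auto
  qed
  then show ?case using Cons by (auto simp: vspan_map[OF u(1)])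
qed simp

text \<open>The list \<open>ps\<close> bounds the kernel from below. From above, \<open>A\<close> is
  injective on the span of \<open>ws\<close>, so this span meets the kernel only in 0, and the
  product of their sizes is at most \<open>CARD('a) ^ n\<close>.\<close>

lemma kernel_dim_eqI:
  fixes A :: "'a::{field,finite} mat"
  assumes A: "A \<in> carrier_mat n n" and ps: "set ps \<subseteq> mat_kernel A" "vindep n ps"
    and ws: "set ws \<subseteq> carrier_vec n" "vindep n (map ((*\<^sub>v) A) ws)" and len: "length ps + length ws = n"
  shows "kernel_dim A = length ps"
proof -
  let ?q = "CARD('a)"
  note K = vsubspace_mat_kernel[OF A]
  have "set (map ((*\<^sub>v) A) ws) \<subseteq> carrier_vec n"
    using A ws by (auto intro!: mult_mat_vec_carrier[of A n n])
  from card_vspan_vindep[OF this ws(2)]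
  have img: "card ((*\<^sub>v) A ` vspan n ws) = ?q ^ length ws" by (simp add: vspan_map[OF A ws(1)])
  then have ge: "?q ^ length ws \<le> card (vspan n ws)" by (metis card_image_le finite_vspan)
  \<comment> \<open>The span of \<open>ws\<close> has at most \<open>CARD('a) ^ length ws\<close>
    elements, and its image has exactly that many, so no two of them can collide.\<close>
  with img card_vspan_le[of n ws] have inj: "inj_on ((*\<^sub>v) A) (vspan n ws)"
    by (intro eq_card_imp_inj_on) auto
  have "mat_kernel A \<inter> vspan n ws \<subseteq> {0\<^sub>v n}"
  proof
    fix x assume x: "x \<in> mat_kernel A \<inter> vspan n ws"
    then have "A *\<^sub>v x = A *\<^sub>v 0\<^sub>v n" using mat_kernelD[OF A, of x] A by auto
    then show "x \<in> {0\<^sub>v n}"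
      using inj_onD[OF inj] x vsubspace_zero[OF vsubspace_vspan[OF ws(1)]] by blast
  qed
  then have "card (mat_kernel A \<inter> vspan n ws) \<le> 1" using card_mono[of "{0\<^sub>v n}"] by simp
  then have "card (mat_kernel A) * card (vspan n ws) \<le> ?q ^ n"
    using card_mult_vsubspaces_le[OF K vsubspace_vspan[OF ws(1)]]
    by (metis (no_types, lifting) mult.right_neutral mult_le_mono2 order.trans)
  then have "card (mat_kernel A) * ?q ^ length ws \<le> ?q ^ length ps * ?q ^ length ws"
    using ge by (metis len mult_le_mono2 order.trans power_add)
  then have le: "card (mat_kernel A) \<le> ?q ^ length ps" by simp
  have "?q ^ length ps = card (vspan n ps)"
    using ps vsubspace_subset[OF K] by (intro card_vspan_vindep[symmetric]) auto
  also have "\<dots> \<le> card (mat_kernel A)"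
    using finite_vsubspace[OF K] vspan_subset[OF K ps(1)] by (rule card_mono)
  finally have "?q ^ kernel_dim A = ?q ^ length ps" using le by (simp add: card_mat_kernel)
  then show ?thesis using two_le_card_field[where 'a = 'a] by (simp add: power_inject_exp)
qed

section \<open>Invertible matrices with prescribed coincidence spaces\<close>

text \<open>When \<open>W\<close> is a subspace with \<open>CARD('a) ^ d\<close> elements, these are
  its ordered bases.\<close>

definition bases :: "nat \<Rightarrow> 'a::field vec set \<Rightarrow> nat \<Rightarrow> 'a vec list set" where
  "bases n W d = {ws. set ws \<subseteq> W \<and> length ws = d \<and> vindep n ws}"

lemma finite_bases: "finite W \<Longrightarrow> finite (bases n W d)"
  using finite_lists_length_eq[of W d] by (rule rev_finite_subset) (auto simp: bases_def)

lemma card_bases_le: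
  assumes "finite W"
  shows "card (bases n W d) \<le> card W ^ d"
proof -
  have "card (bases n W d) \<le> card {ws. set ws \<subseteq> W \<and> length ws = d}"
    by (rule card_mono[OF finite_lists_length_eq[OF assms]]) (auto simp: bases_def)
  then show ?thesis using assms by (simp add: card_lists_length_eq)
qed

definition coincidence_GL :: "nat \<Rightarrow> 'a::field mat \<Rightarrow> nat \<Rightarrow> nat \<Rightarrow> 'a mat set" where
  "coincidence_GL n c a b =
    {u \<in> GL n. kernel_dim (u - 1\<^sub>m n) = a \<and> kernel_dim (u - c) = b}"

definition framed_GL :: "nat \<Rightarrow> 'a::field mat \<Rightarrow> nat \<Rightarrow> nat \<Rightarrow> ('a mat \<times> 'a vec list \<times> 'a vec list) set" where
  "framed_GL n c a b = (SIGMA u : coincidence_GL n c a b.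
     bases n (mat_kernel (u - 1\<^sub>m n)) a \<times> bases n (mat_kernel (u - c)) b)"

context
  fixes n :: nat and c :: "'a::{field,finite} mat"
  assumes c: "c \<in> carrier_mat n n" and c0: "mat_kernel c \<subseteq> {0\<^sub>v n}"
    and c1: "mat_kernel (c - 1\<^sub>m n) \<subseteq> {0\<^sub>v n}"
begin

lemma coincidence_GL_D:
  assumes "u \<in> coincidence_GL n c a b"
  shows "u \<in> GL n" "u \<in> carrier_mat n n"
    "vsubspace n (mat_kernel (u - 1\<^sub>m n))" "card (mat_kernel (u - 1\<^sub>m n)) = CARD('a) ^ a"
    "vsubspace n (mat_kernel (u - c))" "card (mat_kernel (u - c)) = CARD('a) ^ b"
proof -
  show "u \<in> GL n" and u: "u \<in> carrier_mat n n" using assms by (auto simp: coincidence_GL_def GL_def)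
  show "vsubspace n (mat_kernel (u - 1\<^sub>m n))" "vsubspace n (mat_kernel (u - c))"
    by (rule vsubspace_mat_kernel[OF minus_carrier_mat[OF one_carrier_mat]],
        rule vsubspace_mat_kernel[OF minus_carrier_mat[OF c]])
  show "card (mat_kernel (u - 1\<^sub>m n)) = CARD('a) ^ a" "card (mat_kernel (u - c)) = CARD('a) ^ b"
    using assms by (simp_all add: coincidence_GL_def card_mat_kernel)
qed

lemma finite_coincidence_GL: "finite (coincidence_GL n c a b)"
  using finite_GL[of n] by (rule rev_finite_subset) (auto simp: coincidence_GL_def)

lemma finite_framed_GL: "finite (framed_GL n c a b)"
  unfolding framed_GL_def
proof (rule finite_SigmaI[OF finite_coincidence_GL])
  fix u assume "u \<in> coincidence_GL n c a b"
  note D = coincidence_GL_D[OF this]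
  show "finite (bases n (mat_kernel (u - 1\<^sub>m n)) a \<times> bases n (mat_kernel (u - c)) b)"
    using D by (intro finite_cartesian_product finite_bases finite_vsubspace)
qed

lemma card_framed_GL_le:
  "card (framed_GL n c a b) \<le> card (coincidence_GL n c a b) * CARD('a) ^ (a * a + b * b)"
proof -
  have "card (framed_GL n c a b) = (\<Sum>u\<in>coincidence_GL n c a b.
      card (bases n (mat_kernel (u - 1\<^sub>m n)) a) * card (bases n (mat_kernel (u - c)) b))"
    unfolding framed_GL_def using coincidence_GL_D finite_coincidence_GL
    by (subst card_SigmaI)
      (auto simp: card_cartesian_product intro!: finite_cartesian_product finite_bases finite_vsubspace)
  also have "\<dots> \<le> (\<Sum>u\<in>coincidence_GL n c a b. CARD('a) ^ (a * a + b * b))"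
  proof (rule sum_mono)
    fix u assume u: "u \<in> coincidence_GL n c a b"
    note D = coincidence_GL_D[OF u]
    have "card (bases n (mat_kernel (u - 1\<^sub>m n)) a) \<le> (CARD('a) ^ a) ^ a"
      using card_bases_le[OF finite_vsubspace[OF D(3)], of n a] by (simp add: D(4))
    moreover have "card (bases n (mat_kernel (u - c)) b) \<le> (CARD('a) ^ b) ^ b"
      using card_bases_le[OF finite_vsubspace[OF D(5)], of n b] by (simp add: D(6))
    ultimately show "card (bases n (mat_kernel (u - 1\<^sub>m n)) a) * card (bases n (mat_kernel (u - c)) b)
        \<le> CARD('a) ^ (a * a + b * b)"
      by (simp only: power_add power_mult mult_le_mono)
  qed
  finally show ?thesis by simp
qed

text \<open>The loss 256 is 16 squared: one factor 16 from \<open>card_vindep_lists_ge\<close> for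
  each of the two kernels.\<close>

lemma card_framed_GL_ge:
  "real (card (coincidence_GL n c a b)) * (real CARD('a) ^ (a * a + b * b) / 256)
    \<le> real (card (framed_GL n c a b))"
  unfolding framed_GL_def
proof (rule card_Sigma_ge)
  fix u assume u: "u \<in> coincidence_GL n c a b"
  note D = coincidence_GL_D[OF u]
  show "finite (bases n (mat_kernel (u - 1\<^sub>m n)) a \<times> bases n (mat_kernel (u - c)) b)"
    using D by (intro finite_cartesian_product finite_bases finite_vsubspace)
  have "real CARD('a) ^ (a * a) / 16 \<le> real (card (bases n (mat_kernel (u - 1\<^sub>m n)) a))"
    unfolding bases_def by (rule card_vindep_lists_ge[OF D(3,4)]) simp
  moreover have "real CARD('a) ^ (b * b) / 16 \<le> real (card (bases n (mat_kernel (u - c)) b))"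
    unfolding bases_def by (rule card_vindep_lists_ge[OF D(5,6)]) simp
  ultimately have "(real CARD('a) ^ (a * a) / 16) * (real CARD('a) ^ (b * b) / 16)
    \<le> real (card (bases n (mat_kernel (u - 1\<^sub>m n)) a)) * real (card (bases n (mat_kernel (u - c)) b))"
    by (intro mult_mono) auto
  then show "real CARD('a) ^ (a * a + b * b) / 256
      \<le> real (card (bases n (mat_kernel (u - 1\<^sub>m n)) a \<times> bases n (mat_kernel (u - c)) b))"
    by (simp add: card_cartesian_product power_add)
qed (rule finite_coincidence_GL)

text \<open>A vector in both kernels satisfies \<open>x = u x = c x\<close>, so it lies in the
  kernel of \<open>c - 1\<close>, which is trivial. Hence bases of the two kernels can be
  concatenated.\<close>

lemma framed_GL_D:
  assumes "(u, ps, qs) \<in> framed_GL n c a b"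
  shows "u \<in> carrier_mat n n" "set ps \<subseteq> carrier_vec n" "set qs \<subseteq> carrier_vec n"
    "length ps = a" "length qs = b" "vindep n (ps @ qs)"
    "\<And>x. x \<in> set ps \<Longrightarrow> u *\<^sub>v x = x" "\<And>x. x \<in> set qs \<Longrightarrow> u *\<^sub>v x = c *\<^sub>v x"
proof -
  have u: "u \<in> coincidence_GL n c a b"
    and ps: "set ps \<subseteq> mat_kernel (u - 1\<^sub>m n)" "length ps = a" "vindep n ps"
    and qs: "set qs \<subseteq> mat_kernel (u - c)" "length qs = b" "vindep n qs"
    using assms by (auto simp: framed_GL_def bases_def)
  note D = coincidence_GL_D[OF u]
  note k1 = mem_mat_kernel_diff[OF D(2) one_carrier_mat]
  note kc = mem_mat_kernel_diff[OF D(2) c]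
  show "u \<in> carrier_mat n n" "length ps = a" "length qs = b" using D ps qs by auto
  show ps': "set ps \<subseteq> carrier_vec n" and qs': "set qs \<subseteq> carrier_vec n" using ps qs k1 kc by auto
  show "\<And>x. x \<in> set ps \<Longrightarrow> u *\<^sub>v x = x" using ps k1 by auto
  show "\<And>x. x \<in> set qs \<Longrightarrow> u *\<^sub>v x = c *\<^sub>v x" using qs kc by auto
  have "mat_kernel (u - 1\<^sub>m n) \<inter> mat_kernel (u - c) \<subseteq> mat_kernel (c - 1\<^sub>m n)"
    using k1 kc mem_mat_kernel_diff[OF c one_carrier_mat] by auto
  then have "vspan n ps \<inter> vspan n qs \<subseteq> {0\<^sub>v n}"
    using c1 vspan_subset[OF D(3) ps(1)] vspan_subset[OF D(5) qs(1)] by blast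
  then show "vindep n (ps @ qs)" by (intro vindep_append ps' qs' ps qs)
qed

section \<open>Upper bound for the number of matrices with given coincidence dimensions\<close>

lemma card_coincidence_GL_le:
  assumes "a + b \<le> n"
  shows "real (card (coincidence_GL n c a b)) * real CARD('a) ^ (a * a + b * b)
    \<le> 256 * real CARD('a) ^ (n * n)"
proof -
  \<comment> \<open>One completion to a basis is fixed for each list. Since it depends on
    \<open>ps @ qs\<close> alone, the list of images encoding \<open>(u, ps, qs)\<close> can be
    decoded: its tail gives the frame, the frame gives the completion, and then \<open>u\<close> is
    known on a basis.\<close>
  define ext :: "'a vec list \<Rightarrow> 'a vec list" where
    "ext = (\<lambda>ws. SOME rs. set rs \<subseteq> carrier_vec n \<and> length rs = n - length ws \<and> vindep n (rs @ ws))"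
  have ext: "set (ext ws) \<subseteq> carrier_vec n" "length (ext ws) = n - length ws" "vindep n (ext ws @ ws)"
    if "set ws \<subseteq> carrier_vec n" "vindep n ws" "length ws \<le> n" for ws
    using someI_ex[OF vindep_extend[OF that]] unfolding ext_def by auto
  let ?F = "\<lambda>(u, ps, qs). map ((*\<^sub>v) u) (ext (ps @ qs)) @ ps @ qs"
  let ?L = "{ws :: 'a vec list. set ws \<subseteq> carrier_vec n \<and> length ws = n}"
  have "card (framed_GL n c a b) \<le> card ?L"
  proof (rule card_inj_on_le)
    show "finite ?L" by (rule finite_lists_length_eq) simp
    show "?F ` framed_GL n c a b \<subseteq> ?L"
    proof (rule image_subsetI)
      fix t assume "t \<in> framed_GL n c a b"
      then obtain u ps qs where t: "t = (u, ps, qs)" "(u, ps, qs) \<in> framed_GL n c a b" by (cases t) auto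
      note D = framed_GL_D[OF t(2)]
      have e: "set (ext (ps @ qs)) \<subseteq> carrier_vec n" "length (ext (ps @ qs)) = n - (a + b)"
        using ext[of "ps @ qs"] D assms by auto
      then have "set (map ((*\<^sub>v) u) (ext (ps @ qs))) \<subseteq> carrier_vec n"
        using D(1) by (auto intro!: mult_mat_vec_carrier[of u n n])
      then show "?F t \<in> ?L" using t D e assms by simp
    qed
    show "inj_on ?F (framed_GL n c a b)"
    proof (rule inj_onI)
      fix t t' assume "t \<in> framed_GL n c a b" "t' \<in> framed_GL n c a b" and eq: "?F t = ?F t'"
      then obtain u ps qs u' ps' qs' where t: "t = (u, ps, qs)" "(u, ps, qs) \<in> framed_GL n c a b"
        and t': "t' = (u', ps', qs')" "(u', ps', qs') \<in> framed_GL n c a b"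
        by (cases t, cases t') blast
      note D = framed_GL_D[OF t(2)] and D' = framed_GL_D[OF t'(2)]
      have "length (ps @ qs) = length (ps' @ qs')" "length ps = length ps'" using D D' by auto
      then have pq: "ps = ps'" "qs = qs'"
        and rs: "map ((*\<^sub>v) u) (ext (ps @ qs)) = map ((*\<^sub>v) u') (ext (ps' @ qs'))"
        using eq t(1) t'(1) by (auto simp: append_eq_append_conv)
      have s: "set (ext (ps @ qs) @ ps @ qs) \<subseteq> carrier_vec n"
        "vindep n (ext (ps @ qs) @ ps @ qs)" "length (ext (ps @ qs) @ ps @ qs) = n"
        using ext[of "ps @ qs"] D assms by auto
      have "u = u'"
      proof (rule eq_mat_if_eq_on_spanning[OF D(1) D'(1) s(1) vspan_eq_carrier[OF s]])
        fix x assume "x \<in> set (ext (ps @ qs) @ ps @ qs)"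
        then consider "x \<in> set (ext (ps @ qs))" | "x \<in> set ps" | "x \<in> set qs" by auto
        then show "u *\<^sub>v x = u' *\<^sub>v x"
          using rs D(7,8) D'(7,8) unfolding pq map_eq_conv by cases auto
      qed
      with pq t t' show "t = t'" by simp
    qed
  qed
  then have "card (framed_GL n c a b) \<le> CARD('a) ^ (n * n)" by (simp only: card_lists_carrier_vec)
  then have "real (card (framed_GL n c a b)) \<le> real CARD('a) ^ (n * n)"
    unfolding of_nat_power[symmetric] of_nat_le_iff .
  with card_framed_GL_ge[of a b] show ?thesis by linarith
qed

section \<open>Lower bound by stepwise choice of frames and images\<close>

text \<open>Two subspaces of size \<open>q ^ k\<close> in a space of size \<open>q ^ n\<close> may have both complements too small for
  the union bound when \<open>q = 2\<close>; counting their intersection restores the product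
  \<open>(1 - q ^ (k - n))\<^sup>2\<close>.\<close>

lemma card_common_complement_ge:
  assumes qs: "set qs \<subseteq> carrier_vec n" "vindep n qs" "length qs = b" and le: "a + b \<le> n"
  shows "real CARD('a) ^ (n * a) / 256 \<le> real (card {ps. set ps \<subseteq> carrier_vec n \<and> length ps = a \<and>
    vindep n (ps @ qs) \<and> vindep n (ps @ map ((*\<^sub>v) c) qs)})"
proof -
  define q where "q = real CARD('a)"
  have q: "2 \<le> q" using two_le_card_field[where 'a = 'a] by (simp add: q_def)
  define f where "f = (\<lambda>i. q ^ n * (1 - 1 / q ^ (n - b - i))\<^sup>2)"
  have cqs: "set (map ((*\<^sub>v) c) qs) \<subseteq> carrier_vec n"
    using qs c by (auto intro!: mult_mat_vec_carrier[of c n n])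
  have "1/16 \<le> (\<Prod>i<a. 1 - 1 / q ^ (n - b - i))" using q le by (intro prod_one_minus_ge) auto
  \<comment> \<open>Both spans have to be avoided, so the product enters squared and 16 becomes
    256.\<close>
  from power_mono[OF this, of 2] have "1/256 \<le> (\<Prod>i<a. (1 - 1 / q ^ (n - b - i))\<^sup>2)"
    by (simp add: prod_power_distrib power2_eq_square)
  then have "(q ^ n) ^ a * (1/256) \<le> (q ^ n) ^ a * (\<Prod>i<a. (1 - 1 / q ^ (n - b - i))\<^sup>2)"
    using q by (intro mult_left_mono) auto
  then have "q ^ (n * a) / 256 \<le> (\<Prod>i<a. f i)"
    by (simp add: f_def prod.distrib power_mult)
  also have "\<dots> \<le> real (card {ps. set ps \<subseteq> carrier_vec n \<and> length ps = a \<and>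
      (vindep n (ps @ qs) \<and> vindep n (ps @ map ((*\<^sub>v) c) qs))})"
  proof (rule card_lists_stepwise_ge')
    show "vindep n ([] @ qs) \<and> vindep n ([] @ map ((*\<^sub>v) c) qs)"
      using vindep_map[OF c c0] qs by simp
    show "0 \<le> f i" for i using q by (simp add: f_def)
    fix ps assume ps: "set ps \<subseteq> carrier_vec n" "length ps < a"
      and ind: "vindep n (ps @ qs) \<and> vindep n (ps @ map ((*\<^sub>v) c) qs)"
    define X where "X = vspan n (ps @ qs)"
    define Y where "Y = vspan n (ps @ map ((*\<^sub>v) c) qs)"
    define k where "k = length ps + b"
    have k: "k < n" "n - b - length ps = n - k" using ps le by (auto simp: k_def)
    have card: "real (card X) = q ^ k" "real (card Y) = q ^ k"
      using ps ind qs cqs by (simp_all add: X_def Y_def card_vspan_vindep k_def q_def)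
    have "card X * card Y \<le> CARD('a) ^ n * card (X \<inter> Y)"
      unfolding X_def Y_def using ps qs cqs by (intro card_mult_vsubspaces_le vsubspace_vspan) auto
    then have "real (card X) * real (card Y) \<le> q ^ n * real (card (X \<inter> Y))"
      unfolding q_def of_nat_power[symmetric] of_nat_mult[symmetric] of_nat_le_iff .
    then have int: "q ^ k * q ^ k / q ^ n \<le> real (card (X \<inter> Y))"
      using q card by (simp add: divide_simps mult.commute)
    \<comment> \<open>The square in \<open>f\<close> is exactly what inclusion-exclusion yields when
      the intersection has its least possible size \<open>q ^ k * q ^ k / q ^ n\<close>.\<close>
    have "f (length ps) = q ^ n - 2 * q ^ k + q ^ k * q ^ k / q ^ n"
    proof -
      define s where "s = q ^ (n - k)"
      have "q ^ n = q ^ k * s" using k by (simp add: s_def flip: power_add)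
      moreover have "p * s * (1 - 1 / s)\<^sup>2 = p * s - 2 * p + p * p / (p * s)" if "p > 0" for p
        using that q by (simp add: s_def field_simps power2_eq_square)
      ultimately show ?thesis
        unfolding f_def k(2) s_def[symmetric] using q by simp
    qed
    also have "\<dots> \<le> q ^ n - real (card (X \<union> Y))"
      using int card card_Un_Int[of X Y] by (simp add: X_def Y_def)
    also have "\<dots> = real (card (carrier_vec n :: 'a vec set)) - real (card (X \<union> Y))"
      by (simp add: card_carrier_vec q_def)
    also have "\<dots> \<le> real (card (carrier_vec n - (X \<union> Y)))"
      using diff_card_le_card_Diff[of "X \<union> Y" "carrier_vec n"] by (simp add: X_def Y_def)
    also have "carrier_vec n - (X \<union> Y) = {x \<in> carrier_vec n.
        vindep n ((x # ps) @ qs) \<and> vindep n ((x # ps) @ map ((*\<^sub>v) c) qs)}"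
      using ind by (auto simp: X_def Y_def)
    finally show "f (length ps) \<le> real (card \<dots>)" .
  qed simp
  finally show ?thesis by (simp add: q_def)
qed

text \<open>Here \<open>u\<close> is prescribed on the basis \<open>rs @ ps @ qs\<close>: it fixes \<open>ps\<close>, agrees with \<open>c\<close> on \<open>qs\<close> and
  maps \<open>rs\<close> to \<open>rs'\<close>. The three conditions say that \<open>u\<close> is invertible, that \<open>u - 1\<close> is injective on the
  span of \<open>rs @ qs\<close>, and that \<open>u - c\<close> is injective on the span of \<open>rs @ ps\<close>.\<close>

definition admissible_images :: "'a vec list \<Rightarrow> 'a vec list \<Rightarrow> 'a vec list \<Rightarrow> 'a vec list \<Rightarrow> bool" where
  "admissible_images ps qs rs rs' \<longleftrightarrow>
     vindep n (rs' @ ps @ map ((*\<^sub>v) c) qs) \<and>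
     vindep n (map2 (-) rs' rs @ map ((*\<^sub>v) (c - 1\<^sub>m n)) qs) \<and>
     vindep n (map2 (-) rs' (map ((*\<^sub>v) c) rs) @ map ((*\<^sub>v) (1\<^sub>m n - c)) ps)"

lemma mat_kernel_one_diff: "mat_kernel (1\<^sub>m n - c) \<subseteq> {0\<^sub>v n}"
proof
  fix x assume "x \<in> mat_kernel (1\<^sub>m n - c)"
  then have "x \<in> mat_kernel (c - 1\<^sub>m n)"
    using mem_mat_kernel_diff[OF c one_carrier_mat] mem_mat_kernel_diff[OF one_carrier_mat c] by metis
  then show "x \<in> {0\<^sub>v n}" using c1 by auto
qed

lemma set_map2_minus_subset:
  assumes "set xs \<subseteq> carrier_vec n" "set ys \<subseteq> carrier_vec n"
  shows "set (map2 (-) xs ys) \<subseteq> (carrier_vec n :: 'a vec set)"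
proof
  fix z assume "z \<in> set (map2 (-) xs ys)"
  then obtain x y where "(x, y) \<in> set (zip xs ys)" "z = x - y" by auto
  moreover from this have "x \<in> set xs" "y \<in> set ys" by (auto dest: set_zip_leftD set_zip_rightD)
  then have "x \<in> carrier_vec n" "y \<in> carrier_vec n" using assms by auto
  ultimately show "z \<in> carrier_vec n" by simp
qed

lemma set_map_mult_subset:
  "A \<in> carrier_mat n n \<Longrightarrow> set xs \<subseteq> carrier_vec n \<Longrightarrow> set (map ((*\<^sub>v) A) xs) \<subseteq> (carrier_vec n :: 'a vec set)"
  by (auto intro!: mult_mat_vec_carrier[of A n n])

text \<open>The last two conditions of \<open>admissible_images\<close> forbid a new image
  \<open>x\<close> through \<open>x - r\<close> or \<open>x - c r\<close>, so the excluded sets are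
  translates of spans.\<close>

lemma card_translate_le:
  assumes "finite S" "r \<in> carrier_vec n"
  shows "card {x \<in> carrier_vec n. x - r \<in> (S :: 'a vec set)} \<le> card S"
proof (rule card_inj_on_le[where f = "\<lambda>x. x - r"])
  show "inj_on (\<lambda>x. x - r) {x \<in> carrier_vec n. x - r \<in> S}"
    by (intro inj_onI) (rule diff_vec_right_cancel[of _ n _ r], use assms in simp_all)
qed (use assms in auto)

text \<open>After \<open>i\<close> images are chosen, the three conditions exclude at most
  \<open>q ^ (i + a + b)\<close>, \<open>q ^ (i + b)\<close> and \<open>q ^ (i + a)\<close> vectors.
  The union bound suffices here because \<open>a\<close> and \<open>b\<close> are at least 2, which
  makes the last two sets small beside the first.\<close>

lemma card_admissible_images_ge:
  assumes ps: "set ps \<subseteq> carrier_vec n" "length ps = a" and qs: "set qs \<subseteq> carrier_vec n" "length qs = b"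
    and rs: "set rs \<subseteq> carrier_vec n" "length rs = g"
    and n: "a + b + g = n" and ab: "2 \<le> a" "2 \<le> b"
    and ind: "vindep n (ps @ qs)" "vindep n (ps @ map ((*\<^sub>v) c) qs)" "vindep n ps" "vindep n qs"
  shows "real CARD('a) ^ (n * g) / 16 \<le>
    real (card {rs'. set rs' \<subseteq> carrier_vec n \<and> length rs' = g \<and> admissible_images ps qs rs rs'})"
proof -
  define q where "q = real CARD('a)"
  have q: "2 \<le> q" using two_le_card_field[where 'a = 'a] by (simp add: q_def)
  \<comment> \<open>The three terms are the sizes of the excluded sets relative to
    \<open>q ^ (i + a + b) = q ^ n / q ^ (g - i)\<close>. Each of the two fractions is at most 1/4,
    so \<open>t\<close> stays within the range of \<open>prod_one_minus_ge\<close>.\<close>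
  define t where "t = 1 + 1 / q ^ a + 1 / q ^ b"
  have "1 / q ^ d \<le> 1 / 4" if "2 \<le> d" for d
  proof -
    have "(2::real) ^ 2 \<le> q ^ 2" using q by (intro power_mono) auto
    also have "\<dots> \<le> q ^ d" using that q by (intro power_increasing) auto
    finally show ?thesis using q by (simp add: divide_simps)
  qed
  from this[OF ab(1)] this[OF ab(2)] have t: "t \<le> 3/2" unfolding t_def by linarith
  have "0 \<le> t" using q by (simp add: t_def)
  note t = this t
  define f where "f = (\<lambda>i. q ^ n * (1 - t / q ^ (g - i)))"
  have c': "c - 1\<^sub>m n \<in> carrier_mat n n" "1\<^sub>m n - c \<in> carrier_mat n n" using c by auto
  have "1/16 \<le> (\<Prod>i<g. 1 - t / q ^ (g - i))" using q t by (intro prod_one_minus_ge) auto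
  then have "(q ^ n) ^ g * (1/16) \<le> (q ^ n) ^ g * (\<Prod>i<g. 1 - t / q ^ (g - i))"
    using q by (intro mult_left_mono) auto
  then have "q ^ (n * g) / 16 \<le> (\<Prod>i<length rs. f i)"
    by (simp add: f_def prod.distrib power_mult rs)
  also have "\<dots> \<le> real (card {rs'. set rs' \<subseteq> carrier_vec n \<and> length rs' = length rs \<and>
      admissible_images ps qs rs rs'})"
  proof (rule card_lists_stepwise_ge[OF _ _ rs(1)])
    show "admissible_images ps qs [] []"
      unfolding admissible_images_def
      using ind vindep_map[OF c'(1) c1 qs(1)] vindep_map[OF c'(2) mat_kernel_one_diff ps(1)] by simp
    show "0 \<le> f i" if "i < g" for i
    proof -
      have "q ^ 1 \<le> q ^ (g - i)" using q that by (intro power_increasing) auto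
      then have "t \<le> q ^ (g - i)" using q t by simp
      then show ?thesis using q by (simp add: f_def)
    qed
    fix r rs xs
    assume r: "r \<in> (carrier_vec n :: 'a vec set)" and rs: "set rs \<subseteq> carrier_vec n"
      and xs: "set xs \<subseteq> (carrier_vec n :: 'a vec set)" "length xs = length rs" and lt: "length rs < g"
      and adm: "admissible_images ps qs rs xs"
    define i where "i = length rs"
    define X where "X = vspan n (xs @ ps @ map ((*\<^sub>v) c) qs)"
    define Y where "Y = vspan n (map2 (-) xs rs @ map ((*\<^sub>v) (c - 1\<^sub>m n)) qs)"
    define Z where "Z = vspan n (map2 (-) xs (map ((*\<^sub>v) c) rs) @ map ((*\<^sub>v) (1\<^sub>m n - c)) ps)"
    define Y' where "Y' = {x \<in> carrier_vec n. x - r \<in> Y}"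
    define Z' where "Z' = {x \<in> carrier_vec n. x - c *\<^sub>v r \<in> Z}"
    have fin: "finite X" "finite Y" "finite Z" by (simp_all add: X_def Y_def Z_def)
    have "card X = CARD('a) ^ length (xs @ ps @ map ((*\<^sub>v) c) qs)" unfolding X_def
      using adm xs ps qs set_map_mult_subset[OF c qs(1)]
      by (intro card_vspan_vindep) (auto simp: admissible_images_def)
    then have X: "real (card X) = q ^ (i + a + b)" by (simp add: xs ps qs q_def i_def add.assoc)
    have "card Y = CARD('a) ^ length (map2 (-) xs rs @ map ((*\<^sub>v) (c - 1\<^sub>m n)) qs)" unfolding Y_def
      using adm set_map2_minus_subset[OF xs(1) rs] set_map_mult_subset[OF c'(1) qs(1)]
      by (intro card_vspan_vindep) (auto simp: admissible_images_def)
    then have "real (card Y) = q ^ (i + b)" by (simp add: xs ps qs q_def i_def)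
    moreover have "card Y' \<le> card Y" unfolding Y'_def by (rule card_translate_le[OF fin(2) r])
    ultimately have Y: "real (card Y') \<le> q ^ (i + b)" by linarith
    have "card Z = CARD('a) ^ length (map2 (-) xs (map ((*\<^sub>v) c) rs) @ map ((*\<^sub>v) (1\<^sub>m n - c)) ps)"
      unfolding Z_def
      using adm set_map2_minus_subset[OF xs(1) set_map_mult_subset[OF c rs]] set_map_mult_subset[OF c'(2) ps(1)]
      by (intro card_vspan_vindep) (auto simp: admissible_images_def)
    then have "real (card Z) = q ^ (i + a)" by (simp add: xs ps qs q_def i_def)
    moreover have "card Z' \<le> card Z"
      unfolding Z'_def using c r by (intro card_translate_le[OF fin(3)] mult_mat_vec_carrier[of c n n])
    ultimately have Z: "real (card Z') \<le> q ^ (i + a)" by linarith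
    have "i + a + b + (g - i) = n" using lt n by (simp add: i_def)
    then have qn: "q ^ n = q ^ i * q ^ a * q ^ b * q ^ (g - i)" by (metis power_add)
    have "f i = q ^ n - q ^ (i + a + b) - q ^ (i + b) - q ^ (i + a)"
    proof -
      have "I * A * B * S * (1 - (1 + 1 / A + 1 / B) / S) = I * A * B * S - I * A * B - I * B - I * A"
        if "A > 0" "B > 0" "S > 0" for I A B S :: real
        using that by (simp add: field_simps)
      from this[of "q ^ a" "q ^ b" "q ^ (g - i)" "q ^ i"] show ?thesis
        using q unfolding f_def qn t_def power_add by simp
    qed
    also have "\<dots> \<le> q ^ n - real (card (X \<union> Y' \<union> Z'))"
      using X Y Z card_Un_le[of "X \<union> Y'" Z'] card_Un_le[of X Y'] by linarith
    also have "\<dots> = real (card (carrier_vec n :: 'a vec set)) - real (card (X \<union> Y' \<union> Z'))"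
      by (simp add: card_carrier_vec q_def)
    also have "\<dots> \<le> real (card (carrier_vec n - (X \<union> Y' \<union> Z')))"
      using diff_card_le_card_Diff[of "X \<union> Y' \<union> Z'" "carrier_vec n"] fin by (simp add: Y'_def Z'_def)
    also have "carrier_vec n - (X \<union> Y' \<union> Z') = {x \<in> carrier_vec n. admissible_images ps qs (r # rs) (x # xs)}"
      using adm by (auto simp: X_def Y_def Z_def Y'_def Z'_def admissible_images_def)
    finally show "f (length rs) \<le> real (card \<dots>)" by (simp add: i_def)
  qed (use rs in auto)
  finally show ?thesis by (simp add: q_def rs)
qed

text \<open>The first condition sends a basis to a basis, which makes \<open>u\<close> invertible.
  The other two supply the injectivity that \<open>kernel_dim_eqI\<close> asks for, so neither
  kernel exceeds its frame.\<close>

lemma framed_GL_of_admissible: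
  assumes ps: "set ps \<subseteq> carrier_vec n" "length ps = a" and qs: "set qs \<subseteq> carrier_vec n" "length qs = b"
    and rs: "set rs \<subseteq> carrier_vec n" "length rs = g" and rs': "set rs' \<subseteq> carrier_vec n" "length rs' = g"
    and n: "a + b + g = n" and ind: "vindep n (rs @ ps @ qs)" "vindep n ps" "vindep n qs"
    and adm: "admissible_images ps qs rs rs'"
  obtains u where "(u, ps, qs) \<in> framed_GL n c a b" "map ((*\<^sub>v) u) rs = rs'"
proof -
  have "set (rs @ ps @ qs) \<subseteq> carrier_vec n" "length (rs @ ps @ qs) = n"
    "set (rs' @ ps @ map ((*\<^sub>v) c) qs) \<subseteq> carrier_vec n" "length (rs' @ ps @ map ((*\<^sub>v) c) qs) = n"
    using ps qs rs rs' n set_map_mult_subset[OF c qs(1)] by auto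
  then obtain u where u: "u \<in> GL n"
    "map ((*\<^sub>v) u) (rs @ ps @ qs) = rs' @ ps @ map ((*\<^sub>v) c) qs"
    using ind(1) adm GL_of_basis_images[of "rs @ ps @ qs" n "rs' @ ps @ map ((*\<^sub>v) c) qs"]
    by (auto simp: admissible_images_def)
  then have uc: "u \<in> carrier_mat n n" by (simp add: GL_def)
  have maps: "map ((*\<^sub>v) u) rs = rs'" "map ((*\<^sub>v) u) ps = ps" "map ((*\<^sub>v) u) qs = map ((*\<^sub>v) c) qs"
    using u(2) rs rs' by (auto simp: append_eq_append_conv)
  have up: "u *\<^sub>v x = x" if "x \<in> set ps" for x
    using maps(2) that by (metis map_eq_conv map_ident)
  have uq: "u *\<^sub>v x = c *\<^sub>v x" if "x \<in> set qs" for x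
    using maps(3) that unfolding map_eq_conv by simp
  have kp: "set ps \<subseteq> mat_kernel (u - 1\<^sub>m n)"
    using up ps mem_mat_kernel_diff[OF uc one_carrier_mat] by auto
  have kq: "set qs \<subseteq> mat_kernel (u - c)" using uq qs mem_mat_kernel_diff[OF uc c] by auto
  have map_diff: "map ((*\<^sub>v) (A - B)) xs = map2 (-) (map ((*\<^sub>v) A) xs) (map ((*\<^sub>v) B) xs)"
    if "A \<in> carrier_mat n n" "B \<in> carrier_mat n n" "set xs \<subseteq> carrier_vec n" for A B :: "'a mat" and xs
    using that(3) by (induction xs) (auto simp: minus_mult_distrib_mat_vec[OF that(1,2)])
  have one: "map ((*\<^sub>v) (1\<^sub>m n)) xs = xs" if "set xs \<subseteq> carrier_vec n" for xs :: "'a vec list"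
    using that by (induction xs) auto
  have m1: "map ((*\<^sub>v) (u - 1\<^sub>m n)) (rs @ qs) = map2 (-) rs' rs @ map ((*\<^sub>v) (c - 1\<^sub>m n)) qs"
    using rs qs uc c by (simp add: map_diff one maps)
  have v1: "vindep n (map ((*\<^sub>v) (u - 1\<^sub>m n)) (rs @ qs))"
    using adm unfolding admissible_images_def m1 by simp
  have k1: "kernel_dim (u - 1\<^sub>m n) = length ps"
    by (rule kernel_dim_eqI[OF minus_carrier_mat[OF one_carrier_mat] kp ind(2) _ v1])
      (use rs ps qs n in auto)
  have mc: "map ((*\<^sub>v) (u - c)) (rs @ ps) = map2 (-) rs' (map ((*\<^sub>v) c) rs) @ map ((*\<^sub>v) (1\<^sub>m n - c)) ps"
    using rs ps uc c by (simp add: map_diff one maps)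
  have vc: "vindep n (map ((*\<^sub>v) (u - c)) (rs @ ps))"
    using adm unfolding admissible_images_def mc by simp
  have kc: "kernel_dim (u - c) = length qs"
    by (rule kernel_dim_eqI[OF minus_carrier_mat[OF c] kq ind(3) _ vc]) (use rs ps qs n in auto)
  from k1 kc have "(u, ps, qs) \<in> framed_GL n c a b"
    using kp kq ps qs ind u(1) by (simp add: framed_GL_def coincidence_GL_def bases_def)
  with maps(1) that show ?thesis by blast
qed

text \<open>The choices are made in the order \<open>qs\<close>, \<open>ps\<close>,
  \<open>rs'\<close>, and the good proportions are at least 1/16, 1/256 and 1/16. Their product is
  1/65536, and a matrix carries at most \<open>q ^ (a * a + b * b)\<close> frames.\<close>

lemma card_coincidence_GL_ge:
  assumes n: "a + b + g = n" and ab: "2 \<le> a" "2 \<le> b"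
  shows "real CARD('a) ^ (n * n) / 65536
    \<le> real (card (coincidence_GL n c a b)) * real CARD('a) ^ (a * a + b * b)"
proof -
  define q where "q = real CARD('a)"
  have q: "2 \<le> q" using two_le_card_field[where 'a = 'a] by (simp add: q_def)
  define ext :: "'a vec list \<Rightarrow> 'a vec list" where
    "ext = (\<lambda>ws. SOME rs. set rs \<subseteq> carrier_vec n \<and> length rs = n - length ws \<and> vindep n (rs @ ws))"
  have ext: "set (ext ws) \<subseteq> carrier_vec n" "length (ext ws) = n - length ws" "vindep n (ext ws @ ws)"
    if "set ws \<subseteq> carrier_vec n" "vindep n ws" "length ws \<le> n" for ws
    using someI_ex[OF vindep_extend[OF that]] unfolding ext_def by auto
  define Q where "Q = {qs :: 'a vec list. set qs \<subseteq> carrier_vec n \<and> length qs = b \<and> vindep n qs}"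
  define P where "P = (\<lambda>qs. {ps :: 'a vec list. set ps \<subseteq> carrier_vec n \<and> length ps = a \<and> vindep n ps \<and>
    vindep n (ps @ qs) \<and> vindep n (ps @ map ((*\<^sub>v) c) qs)})"
  define R where "R = (\<lambda>qs ps. {rs'. set rs' \<subseteq> carrier_vec n \<and> length rs' = g \<and>
    admissible_images ps qs (ext (ps @ qs)) rs'})"
  have fin: "finite {xs :: 'a vec list. set xs \<subseteq> carrier_vec n \<and> length xs = m}" for m
    by (rule finite_lists_length_eq) simp
  have finQ: "finite Q" unfolding Q_def by (rule rev_finite_subset[OF fin[of b]]) auto
  have finP: "finite (P qs)" for qs unfolding P_def by (rule rev_finite_subset[OF fin[of a]]) auto
  have finR: "finite (R qs ps)" for qs ps unfolding R_def by (rule rev_finite_subset[OF fin[of g]]) auto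
  have prefix: "vindep n ps" if "vindep n (ps @ qs)" "set ps \<subseteq> carrier_vec n" "set qs \<subseteq> carrier_vec n" for ps qs
    using that(1,2)
  proof (induction ps)
    case (Cons p ps)
    have "vspan n ps \<subseteq> vspan n (ps @ qs)"
      using Cons.prems that(3) vspan_superset[of "ps @ qs" n]
      by (intro vspan_subset vsubspace_vspan) auto
    then show ?case using Cons by auto
  qed simp
  have inner: "q ^ (n * a) / 256 * (q ^ (n * g) / 16) \<le> real (card (Sigma (P qs) (R qs)))"
    if qs: "qs \<in> Q" for qs
  proof -
    \<comment> \<open>Independence passes from \<open>ps @ qs\<close> to its prefix
      \<open>ps\<close>, so \<open>P qs\<close> is the set counted by
      \<open>card_common_complement_ge\<close>.\<close>
    have "{ps. set ps \<subseteq> carrier_vec n \<and> length ps = a \<and> vindep n (ps @ qs) \<and>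
        vindep n (ps @ map ((*\<^sub>v) c) qs)} = P qs"
      using qs prefix by (auto simp: P_def Q_def)
    with card_common_complement_ge[of qs b a] qs n
    have "q ^ (n * a) / 256 \<le> real (card (P qs))" by (simp add: Q_def q_def)
    then have "q ^ (n * a) / 256 * (q ^ (n * g) / 16) \<le> real (card (P qs)) * (q ^ (n * g) / 16)"
      using q by (intro mult_right_mono) auto
    also have "\<dots> \<le> real (card (Sigma (P qs) (R qs)))"
    proof (rule card_Sigma_ge[OF finP finR])
      fix ps assume ps: "ps \<in> P qs"
      show "q ^ (n * g) / 16 \<le> real (card (R qs ps))"
        unfolding R_def q_def using ps qs n ab ext[of "ps @ qs"]
        by (intro card_admissible_images_ge[where a = a and b = b]) (auto simp: P_def Q_def)
    qed
    finally show ?thesis .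
  qed
  have "q ^ (n * b) / 16 \<le> real (card Q)" unfolding Q_def q_def
    using n by (intro card_vindep_lists_ge[OF vsubspace_carrier]) (auto simp: card_carrier_vec)
  then have "q ^ (n * b) / 16 * (q ^ (n * a) / 256 * (q ^ (n * g) / 16))
      \<le> real (card Q) * (q ^ (n * a) / 256 * (q ^ (n * g) / 16))"
    using q by (intro mult_right_mono) auto
  also have "\<dots> \<le> real (card (SIGMA qs : Q. Sigma (P qs) (R qs)))"
    by (rule card_Sigma_ge[OF finQ _ inner]) (auto intro: finite_SigmaI finP finR)
  \<comment> \<open>Each choice is realized by a framed matrix and can be read off from it, because
    the completion depends on the frame alone.\<close>
  also have "card (SIGMA qs : Q. Sigma (P qs) (R qs)) \<le> card (framed_GL n c a b)"
  proof (rule surj_card_le[OF finite_framed_GL])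
    show "(SIGMA qs : Q. Sigma (P qs) (R qs)) \<subseteq>
      (\<lambda>(u, ps, qs). (qs, ps, map ((*\<^sub>v) u) (ext (ps @ qs)))) ` framed_GL n c a b"
    proof
      fix t assume "t \<in> (SIGMA qs : Q. Sigma (P qs) (R qs))"
      then obtain qs ps rs' where t: "t = (qs, ps, rs')" "qs \<in> Q" "ps \<in> P qs" "rs' \<in> R qs ps" by auto
      have pq: "set (ps @ qs) \<subseteq> carrier_vec n" "vindep n (ps @ qs)" "length (ps @ qs) \<le> n"
        using t n by (auto simp: P_def Q_def)
      obtain u where "(u, ps, qs) \<in> framed_GL n c a b" "map ((*\<^sub>v) u) (ext (ps @ qs)) = rs'"
        by (rule framed_GL_of_admissible[of ps a qs b "ext (ps @ qs)" g rs'])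
          (use t n ext[OF pq] in \<open>auto simp: P_def Q_def R_def\<close>)
      then show "t \<in> (\<lambda>(u, ps, qs). (qs, ps, map ((*\<^sub>v) u) (ext (ps @ qs)))) ` framed_GL n c a b"
        using t(1) by (auto intro!: image_eqI[of _ _ "(u, ps, qs)"])
    qed
  qed
  also have "card (framed_GL n c a b) \<le> card (coincidence_GL n c a b) * CARD('a) ^ (a * a + b * b)"
    by (rule card_framed_GL_le)
  also have "q ^ (n * b) / 16 * (q ^ (n * a) / 256 * (q ^ (n * g) / 16)) = q ^ (n * n) / 65536"
  proof -
    have "n * b + (n * a + n * g) = n * n"
      unfolding distrib_left[symmetric] using n by (simp add: ac_simps)
    then have "q ^ (n * n) = q ^ (n * b) * (q ^ (n * a) * q ^ (n * g))" by (simp flip: power_add)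
    then show ?thesis by simp
  qed
  finally show ?thesis by (simp add: q_def)
qed

end

section \<open>Factorizations of regular elliptic elements\<close>

lemma poly_mod_sum_left:
  fixes p :: "'b \<Rightarrow> 'a::field poly"
  shows "(\<Sum>i\<in>S. p i) mod f = (\<Sum>i\<in>S. p i mod f)"
  by (induction S rule: infinite_finite_induct) (auto simp: poly_mod_add_left)

text \<open>Let \<open>p\<close> be the polynomial with coefficient vector \<open>x\<close>. An
  eigenvector equation says that \<open>f\<close> divides \<open>(X - k) * p\<close>. Since
  \<open>f\<close> is prime of degree at least 2, it must divide \<open>p\<close>, whose degree is
  smaller, so \<open>p = 0\<close>.\<close>

lemma mult_x_matrix_no_eigenvector:
  fixes f :: "'a::field poly"
  assumes f: "irreducible f" "degree f = n" "2 \<le> n"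
    and x: "x \<in> carrier_vec n" and eig: "mult_x_matrix f *\<^sub>v x = k \<cdot>\<^sub>v x"
  shows "x = 0\<^sub>v n"
proof -
  define p where "p = (\<Sum>j<n. monom (x $ j) j)"
  have coeff_p: "coeff p i = (if i < n then x $ i else 0)" for i
    unfolding p_def coeff_sum by simp
  then have deg_p: "degree p < n" using f(3) by (intro degree_lessI) auto
  have xp: "monom 1 1 * p = (\<Sum>j<n. Polynomial.smult (x $ j) (monom 1 (j + 1)))"
    unfolding p_def sum_distrib_left by (intro sum.cong) (auto simp: mult_monom smult_monom)
  have "(monom 1 1 * p) mod f = (\<Sum>j<n. Polynomial.smult (x $ j) (monom 1 (j + 1) mod f))"
    unfolding xp poly_mod_sum_left by (simp add: mod_smult_left)
  then have coeff_mod: "coeff ((monom 1 1 * p) mod f) i = (\<Sum>j<n. coeff (monom 1 (j + 1) mod f) i * x $ j)" for i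
    by (simp add: coeff_sum mult.commute)
  have "(monom 1 1 * p) mod f = Polynomial.smult k p"
  proof (rule poly_eqI)
    fix i
    show "coeff ((monom 1 1 * p) mod f) i = coeff (Polynomial.smult k p) i"
    proof (cases "i < n")
      case True
      have "(mult_x_matrix f *\<^sub>v x) $ i = (\<Sum>j<n. coeff (monom 1 (j + 1) mod f) i * x $ j)"
        using True f(2) x by (simp add: mult_x_matrix_def scalar_prod_def atLeast0LessThan)
      moreover have "(k \<cdot>\<^sub>v x) $ i = coeff (Polynomial.smult k p) i" using True x by (simp add: coeff_p)
      ultimately show ?thesis using eig coeff_mod by simp
    next
      case False
      have "f \<noteq> 0" using f by auto
      then have "degree ((monom 1 1 * p) mod f) < n" using degree_mod_less'[of f "monom 1 1 * p"] f
        by (cases "(monom 1 1 * p) mod f = 0") auto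
      then have "coeff ((monom 1 1 * p) mod f) i = 0" using False by (intro coeff_eq_0) auto
      then show ?thesis using False by (simp add: coeff_p)
    qed
  qed
  moreover have "Polynomial.smult k p mod f = Polynomial.smult k p" using deg_p f by (simp add: mod_poly_less)
  ultimately have "(monom 1 1 * p - Polynomial.smult k p) mod f = 0" by (simp add: poly_mod_diff_left)
  moreover have "monom 1 1 * p - Polynomial.smult k p = [:- k, 1:] * p" by (simp add: monom_altdef)
  ultimately have dvd: "f dvd [:- k, 1:] * p" by (simp add: mod_eq_0_iff_dvd)
  have prime: "prime_elem f" using f(1) by (simp add: irreducible_imp_prime_elem)
  from prime_elem_dvd_multD[OF prime dvd] have "f dvd [:- k, 1:] \<or> f dvd p" .
  moreover have "\<not> f dvd [:- k, 1:]"
    using dvd_imp_degree_le[of f "[:- k, 1:]"] f(2,3) by auto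
  ultimately have "p = 0" using dvd_imp_degree_le[of f p] deg_p f(2) by auto
  show ?thesis
  proof (rule eq_vecI)
    fix i assume "i < dim_vec (0\<^sub>v n :: 'a vec)"
    then show "x $ i = 0\<^sub>v n $ i" using coeff_p[of i] \<open>p = 0\<close> by simp
  qed (use x in simp)
qed

text \<open>Change of basis: \<open>Q\<close> carries an eigenvector of \<open>c\<close> to one of
  \<open>mult_x_matrix f\<close> with the same eigenvalue.\<close>

lemma regular_elliptic_no_eigenvector:
  assumes "regular_elliptic n c" "2 \<le> n" and x: "x \<in> carrier_vec n" and eig: "c *\<^sub>v x = k \<cdot>\<^sub>v x"
  shows "x = 0\<^sub>v n"
proof -
  obtain f P Q where f: "irreducible f" "degree f = n"
    and PQ: "P \<in> carrier_mat n n" "Q \<in> carrier_mat n n" "P * Q = 1\<^sub>m n" "Q * P = 1\<^sub>m n"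
    and c: "c = P * mult_x_matrix f * Q"
    using assms(1) unfolding regular_elliptic_def by blast
  have M: "mult_x_matrix f \<in> carrier_mat n n" using f by (simp add: mult_x_matrix_def)
  have "c *\<^sub>v x = P *\<^sub>v (mult_x_matrix f *\<^sub>v (Q *\<^sub>v x))"
    unfolding c using M PQ x by (simp add: assoc_mult_mat_vec[of _ n n _ n])
  then have "Q *\<^sub>v (c *\<^sub>v x) = (Q * P) *\<^sub>v (mult_x_matrix f *\<^sub>v (Q *\<^sub>v x))"
    using M PQ(1,2) x by (simp add: assoc_mult_mat_vec[of _ n n _ n])
  then have "mult_x_matrix f *\<^sub>v (Q *\<^sub>v x) = Q *\<^sub>v (k \<cdot>\<^sub>v x)"
    using M PQ x eig by simp
  also have "\<dots> = k \<cdot>\<^sub>v (Q *\<^sub>v x)" using PQ(2) x by (rule mult_mat_vec)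
  finally have "Q *\<^sub>v x = 0\<^sub>v n"
    using mult_x_matrix_no_eigenvector[OF f assms(2)] PQ(2) x by simp
  moreover have "x = (P * Q) *\<^sub>v x" using PQ(3) x by simp
  moreover have "(P * Q) *\<^sub>v x = P *\<^sub>v (Q *\<^sub>v x)" by (rule assoc_mult_mat_vec[OF PQ(1,2) x])
  moreover have "P *\<^sub>v 0\<^sub>v n = 0\<^sub>v n" using PQ(1) by (intro eq_vecI) auto
  ultimately show ?thesis by metis
qed

text \<open>The eigenvalues 0 and 1 give the two kernel hypotheses under which the counting was
  done.\<close>

lemma regular_elliptic_kernels:
  assumes "regular_elliptic n c" "2 \<le> n"
  shows "c \<in> carrier_mat n n" "mat_kernel c \<subseteq> {0\<^sub>v n}" "mat_kernel (c - 1\<^sub>m n) \<subseteq> {0\<^sub>v n}"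
proof -
  show c: "c \<in> carrier_mat n n" using assms(1) by (simp add: regular_elliptic_def)
  show "mat_kernel c \<subseteq> {0\<^sub>v n}"
  proof
    fix x assume "x \<in> mat_kernel c"
    note x = mat_kernelD[OF c this]
    have "0 \<cdot>\<^sub>v x = 0\<^sub>v n" using x(1) by (intro eq_vecI) auto
    then show "x \<in> {0\<^sub>v n}"
      using regular_elliptic_no_eigenvector[OF assms x(1), of 0] x(2) by simp
  qed
  show "mat_kernel (c - 1\<^sub>m n) \<subseteq> {0\<^sub>v n}"
  proof
    fix x assume "x \<in> mat_kernel (c - 1\<^sub>m n)"
    then have x: "x \<in> carrier_vec n" "c *\<^sub>v x = 1 \<cdot>\<^sub>v x"
      using mem_mat_kernel_diff[OF c one_carrier_mat, of x] by auto
    then show "x \<in> {0\<^sub>v n}" using regular_elliptic_no_eigenvector[OF assms x] by simp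
  qed
qed

text \<open>With trivial kernel, \<open>c\<close> maps a basis to an independent list. Some element
  of \<open>GL n\<close> has the same values on that basis, and so equals \<open>c\<close>.\<close>

lemma GL_if_mat_kernel_trivial:
  fixes c :: "'a::{field,finite} mat"
  assumes c: "c \<in> carrier_mat n n" "mat_kernel c \<subseteq> {0\<^sub>v n}"
  shows "c \<in> GL n"
proof -
  obtain ss :: "'a vec list" where ss: "set ss \<subseteq> carrier_vec n" "vindep n ss" "length ss = n"
    using vindep_extend[of "[]" n] by auto
  have "set (map ((*\<^sub>v) c) ss) \<subseteq> carrier_vec n"
    using c ss by (auto intro!: mult_mat_vec_carrier[of c n n])
  then obtain u where u: "u \<in> GL n" "map ((*\<^sub>v) u) ss = map ((*\<^sub>v) c) ss"
    using GL_of_basis_images[OF ss, of "map ((*\<^sub>v) c) ss"] vindep_map[OF c ss(1,2)] ss(3) by auto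
  moreover have "u = c"
    using u(2) unfolding map_eq_conv
    by (intro eq_mat_if_eq_on_spanning[OF _ c(1) ss(1) vspan_eq_carrier[OF ss]])
      (use u(1) in \<open>auto simp: GL_def\<close>)
  ultimately show ?thesis by simp
qed

lemma GL_mult:
  fixes u v :: "'a::{field,finite} mat"
  assumes "u \<in> GL n" "v \<in> GL n"
  shows "u * v \<in> GL n"
proof (rule GL_if_mat_kernel_trivial)
  obtain u' v' where u': "u' \<in> carrier_mat n n" "u' * u = 1\<^sub>m n" and v': "v' \<in> carrier_mat n n" "v' * v = 1\<^sub>m n"
    using GL_inverse assms by metis
  have u: "u \<in> carrier_mat n n" and v: "v \<in> carrier_mat n n" using assms by (auto simp: GL_def)
  show uv: "u * v \<in> carrier_mat n n" using u v by simp
  show "mat_kernel (u * v) \<subseteq> {0\<^sub>v n}"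
  proof
    fix x assume "x \<in> mat_kernel (u * v)"
    note x = mat_kernelD[OF uv this]
    have "v *\<^sub>v x = (u' * u) *\<^sub>v (v *\<^sub>v x)" using u' v x(1) by simp
    also have "\<dots> = u' *\<^sub>v ((u * v) *\<^sub>v x)"
      using u u'(1) v x(1) by (simp add: assoc_mult_mat_vec[of _ n n _ n])
    also have "\<dots> = 0\<^sub>v n" unfolding x(2) using u'(1) by (intro eq_vecI) auto
    finally have "v *\<^sub>v x = 0\<^sub>v n" .
    moreover have "x = (v' * v) *\<^sub>v x" using v' x(1) by simp
    then have "x = v' *\<^sub>v (v *\<^sub>v x)"
      using v v'(1) x(1) by (simp add: assoc_mult_mat_vec[of _ n n _ n])
    moreover have "v' *\<^sub>v 0\<^sub>v n = 0\<^sub>v n" using v'(1) by (intro eq_vecI) auto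
    ultimately show "x \<in> {0\<^sub>v n}" by simp
  qed
qed

section \<open>Reduction of the genus count to coincidence counts\<close>

lemma N_genus_eq_card:
  fixes c :: "'a::{field,finite} mat"
  assumes c: "c \<in> GL n"
  shows "N_genus g n c = card {u \<in> GL n. kernel_dim (u - 1\<^sub>m n) + kernel_dim (u - c) + g = n}"
proof -
  have cc: "c \<in> carrier_mat n n" using c by (simp add: GL_def)
  have ker: "kernel_dim (v - 1\<^sub>m n) = kernel_dim (u - c)" if u: "u \<in> GL n" and v: "v \<in> GL n" and uv: "u * v = c" for u v
  proof -
    obtain u' where u': "u' \<in> carrier_mat n n" "u' * u = 1\<^sub>m n" using GL_inverse[OF u] by metis
    have u: "u \<in> carrier_mat n n" and v: "v \<in> carrier_mat n n" using u v by (auto simp: GL_def)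
    \<comment> \<open>Since \<open>c x = u (v x)\<close> and \<open>u\<close> is injective,
      \<open>v\<close> fixes \<open>x\<close> exactly when \<open>u\<close> and \<open>c\<close>
      agree at \<open>x\<close>.\<close>
    have iff: "v *\<^sub>v x = x \<longleftrightarrow> u *\<^sub>v x = c *\<^sub>v x" if x: "x \<in> carrier_vec n" for x
    proof
      have cx: "c *\<^sub>v x = u *\<^sub>v (v *\<^sub>v x)" unfolding uv[symmetric] using u v x by simp
      show "u *\<^sub>v x = c *\<^sub>v x" if "v *\<^sub>v x = x" using cx that by simp
      assume "u *\<^sub>v x = c *\<^sub>v x"
      then have "u' *\<^sub>v (u *\<^sub>v (v *\<^sub>v x)) = u' *\<^sub>v (u *\<^sub>v x)" using cx by simp
      moreover have "u' *\<^sub>v (u *\<^sub>v y) = y" if "y \<in> carrier_vec n" for y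
        using u u' that assoc_mult_mat_vec[OF u'(1) u that] by simp
      ultimately show "v *\<^sub>v x = x" using v x by simp
    qed
    have "mat_kernel (v - 1\<^sub>m n) = mat_kernel (u - c)"
      using iff mem_mat_kernel_diff[OF v one_carrier_mat] mem_mat_kernel_diff[OF u cc] by auto
    then have "CARD('a) ^ kernel_dim (v - 1\<^sub>m n) = CARD('a) ^ kernel_dim (u - c)"
      by (metis card_mat_kernel)
    then show ?thesis using two_le_card_field[where 'a = 'a] by simp
  qed
  let ?S = "{(u, v). u \<in> GL n \<and> v \<in> GL n \<and> u * v = c \<and>
      int n - int (kernel_dim (u - 1\<^sub>m n)) - int (kernel_dim (v - 1\<^sub>m n)) = int g}"
  let ?T = "{u \<in> GL n. kernel_dim (u - 1\<^sub>m n) + kernel_dim (u - c) + g = n}"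
  have "bij_betw fst ?S ?T"
    unfolding bij_betw_def
  proof (intro conjI equalityI subsetI)
    show "inj_on fst ?S"
    proof (rule inj_onI)
      fix s t assume st: "s \<in> ?S" "t \<in> ?S" "fst s = fst t"
      then obtain u v w where s: "s = (u, v)" "t = (u, w)" by (cases s, cases t) auto
      with st have uvw: "u \<in> GL n" "v \<in> GL n" "w \<in> GL n" "u * v = u * w" by auto
      obtain u' where u': "u' \<in> carrier_mat n n" "u' * u = 1\<^sub>m n" using GL_inverse[OF uvw(1)] by metis
      have car: "u \<in> carrier_mat n n" "v \<in> carrier_mat n n" "w \<in> carrier_mat n n"
        using uvw by (auto simp: GL_def)
      have "u' * (u * v) = u' * (u * w)" using uvw by simp
      then have "(u' * u) * v = (u' * u) * w" using car u'(1) by (simp add: assoc_mult_mat[of _ n n _ n _ n])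
      then show "s = t" using u' car s by simp
    qed
  next
    fix u assume "u \<in> fst ` ?S"
    then obtain v where "u \<in> GL n" "v \<in> GL n" "u * v = c"
      "int n - int (kernel_dim (u - 1\<^sub>m n)) - int (kernel_dim (v - 1\<^sub>m n)) = int g" by auto
    then show "u \<in> ?T" using ker[of u v] by simp
  next
    fix u assume "u \<in> ?T"
    then have u: "u \<in> GL n" "kernel_dim (u - 1\<^sub>m n) + kernel_dim (u - c) + g = n" by auto
    then have uc: "u \<in> carrier_mat n n" by (simp add: GL_def)
    obtain u' where u': "u' \<in> carrier_mat n n" "u * u' = 1\<^sub>m n" "u' * u = 1\<^sub>m n" using GL_inverse[OF u(1)] .
    have "u' \<in> GL n" using u' uc by (auto simp: GL_def invertible_mat_def inverts_mat_def)
    then have v: "u' * c \<in> GL n" using GL_mult c by blast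
    have "u * (u' * c) = (u * u') * c" using uc u'(1) cc by (rule assoc_mult_mat[symmetric])
    then have uv: "u * (u' * c) = c" using u' cc by simp
    have "(u, u' * c) \<in> ?S" using u v uv ker[OF u(1) v uv] by simp
    then show "u \<in> fst ` ?S" by (metis (no_types, lifting) fst_conv image_eqI)
  qed
  then show ?thesis unfolding N_genus_def by (rule bij_betw_same_card)
qed

text \<open>The matrices are sorted by \<open>a\<close>, the dimension of the kernel of
  \<open>u - 1\<close>; the other dimension is then forced. With \<open>g \<le> n\<close> and
  \<open>a \<le> n - g\<close> the truncated subtractions are exact.\<close>

lemma N_genus_eq_sum:
  fixes c :: "'a::{field,finite} mat"
  assumes c: "c \<in> GL n" and "g \<le> n"
  shows "N_genus g n c = (\<Sum>a\<le>n - g. card (coincidence_GL n c a (n - g - a)))"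
proof -
  have "{u \<in> GL n. kernel_dim (u - 1\<^sub>m n) + kernel_dim (u - c) + g = n}
      = (\<Union>a\<in>{..n - g}. coincidence_GL n c a (n - g - a))"
    using assms(2) by (auto simp: coincidence_GL_def)
  moreover have "finite (coincidence_GL n c a b)" for a b
    using finite_GL[of n] by (rule rev_finite_subset) (auto simp: coincidence_GL_def)
  then have "card (\<Union>a\<in>{..n - g}. coincidence_GL n c a (n - g - a))
      = (\<Sum>a\<le>n - g. card (coincidence_GL n c a (n - g - a)))"
    by (intro card_UN_disjoint) (auto simp: coincidence_GL_def)
  ultimately show ?thesis by (simp add: N_genus_eq_card[OF c])
qed

section \<open>Summation over the splittings of \<open>n - g\<close>, and the exponent
  identity\<close>

lemma sum_half_powers_le: "(\<Sum>j<k. (1/2) ^ j :: real) \<le> 2"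
proof -
  have "(\<Sum>j<k. (1/2) ^ j :: real) = 2 - 2 * (1/2) ^ k" by (induction k) auto
  then show ?thesis by simp
qed

text \<open>Away from the middle the terms decay at least geometrically with ratio 1/2. Each half of
  the range contributes at most 2.\<close>

lemma sum_powr_square_le:
  fixes q :: real
  assumes "2 \<le> q"
  shows "(\<Sum>a\<le>m. q powr - ((2 * real a - real m)\<^sup>2 / 2)) \<le> 4"
proof -
  define h where "h = m div 2"
  \<comment> \<open>The offset from the middle, counted on the right from \<open>Suc h\<close>, so
    that each half runs through 0, 1, 2, ... once. Then \<open>2 * k a\<close> is at most the
    distance of \<open>2 * a\<close> from \<open>m\<close>, for either parity of
    \<open>m\<close>.\<close>
  define k where "k = (\<lambda>a. if a \<le> h then h - a else a - Suc h)"
  have "q powr - ((2 * real a - real m)\<^sup>2 / 2) \<le> (1/2) ^ k a" for a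
  proof -
    have "2 * k a \<le> nat \<bar>2 * int a - int m\<bar>" unfolding k_def h_def by auto
    then have "2 * real (k a) \<le> \<bar>2 * real a - real m\<bar>" by linarith
    then have "(2 * real (k a))\<^sup>2 \<le> (2 * real a - real m)\<^sup>2"
      by (metis abs_le_square_iff abs_of_nonneg mult_nonneg_nonneg of_nat_0_le_iff zero_le_numeral)
    moreover have "real (k a) \<le> (real (k a))\<^sup>2" by (cases "k a") (auto simp: power2_eq_square)
    moreover have "(2 * real (k a))\<^sup>2 = 4 * (real (k a))\<^sup>2" by (simp only: power_mult_distrib) simp
    moreover have "0 \<le> (real (k a))\<^sup>2" by simp
    ultimately have le: "real (k a) \<le> (2 * real a - real m)\<^sup>2 / 2" by linarith
    have "q powr - ((2 * real a - real m)\<^sup>2 / 2) \<le> 2 powr - ((2 * real a - real m)\<^sup>2 / 2)"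
      using assms by (intro powr_mono2') auto
    also have "\<dots> \<le> 2 powr - real (k a)" using le by (intro powr_mono) auto
    also have "\<dots> = (1/2) ^ k a" by (simp add: powr_minus powr_realpow power_one_over inverse_eq_divide)
    finally show ?thesis .
  qed
  then have "(\<Sum>a\<le>m. q powr - ((2 * real a - real m)\<^sup>2 / 2)) \<le> (\<Sum>a\<le>m. (1/2) ^ k a)"
    by (rule sum_mono)
  also have "\<dots> = (\<Sum>a<Suc h. (1/2) ^ k a) + (\<Sum>a=Suc h..<Suc m. (1/2) ^ k a)"
    using sum.atLeastLessThan_concat[of 0 "Suc h" "Suc m" "\<lambda>a. (1/2::real) ^ k a"]
    by (simp add: h_def lessThan_Suc_atMost atLeast0LessThan)
  also have "(\<Sum>a<Suc h. (1/2) ^ k a) = (\<Sum>a<Suc h. (1/2::real) ^ (Suc h - Suc a))"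
    by (intro sum.cong) (auto simp: k_def)
  also have "\<dots> = (\<Sum>j<Suc h. (1/2) ^ j)" by (rule sum.nat_diff_reindex)
  also have "(\<Sum>a=Suc h..<Suc m. (1/2) ^ k a) = (\<Sum>a=Suc h..<Suc m. (1/2::real) ^ (a - Suc h))"
    by (intro sum.cong) (auto simp: k_def)
  also have "\<dots> = (\<Sum>j<m - h. (1/2) ^ j)"
    using sum.shift_bounds_nat_ivl[of "\<lambda>a. (1/2::real) ^ (a - Suc h)" 0 "Suc h" "m - h"]
    by (simp add: h_def atLeast0LessThan)
  finally show ?thesis using sum_half_powers_le[of "Suc h"] sum_half_powers_le[of "m - h"] by linarith
qed

text \<open>The frame count \<open>q ^ (a * a + b * b)\<close> is kept as a separate factor so that
  it cancels against the same factor in both coincidence bounds.\<close>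

lemma powr_genus_exponent:
  fixes q :: real
  assumes "0 < q" "a + b + g = n"
  shows "q ^ (n * n) = q powr ((real n + real g)\<^sup>2 / 2) / q ^ (g * g)
    * q powr - ((real a - real b)\<^sup>2 / 2) * q ^ (a * a + b * b)"
proof -
  have p: "q ^ k = q powr real k" for k using assms(1) by (simp add: powr_realpow)
  have n: "real n = real a + real b + real g" using assms(2) by linarith
  show ?thesis
    unfolding p powr_add[symmetric] powr_diff[symmetric]
    by (rule arg_cong[of _ _ "(powr) q"]) (simp add: n power2_eq_square field_simps)
qed

section \<open>Assembly of the two-sided estimate\<close>

theorem theorem5p1:
  shows "\<exists>C1 C2 :: real. C1 > 0 \<and> C2 > 0 \<and>
    (\<forall>(g::nat) (c :: nat \<Rightarrow> 'a::{finite,field} mat).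
       (\<forall>n\<ge>1. regular_elliptic n (c n)) \<longrightarrow>
       (\<forall>\<^sub>F n in sequentially.
          C1 * (real CARD('a) powr ((real n + real g)^2 / 2) / real (card (GL g :: 'a mat set)))
            \<le> real (N_genus g n (c n)) \<and>
          real (N_genus g n (c n))
            \<le> C2 * (real CARD('a) powr ((real n + real g)^2 / 2) / real (card (GL g :: 'a mat set)))))"
proof -
  define q where "q = real CARD('a)"
  have q: "2 \<le> q" using two_le_card_field[where 'a = 'a] by (simp add: q_def)
  \<comment> \<open>Here 1048576 is 65536 times 16: the loss in
    \<open>card_coincidence_GL_ge\<close> times the loss in \<open>card_GL_ge\<close>. The factor
    \<open>q powr - (1/2)\<close> is the price of an odd \<open>n - g\<close>, where the two
    dimensions cannot be equal.\<close>
  define C1 where "C1 = q powr - (1/2) / 1048576"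
  have "C1 * (q powr ((real n + real g)\<^sup>2 / 2) / real (card (GL g :: 'a mat set))) \<le> real (N_genus g n c) \<and>
      real (N_genus g n c) \<le> 1024 * (q powr ((real n + real g)\<^sup>2 / 2) / real (card (GL g :: 'a mat set)))"
    \<comment> \<open>The threshold makes \<open>m = n - g\<close> at least 4, so both parts of the
      balanced splitting are at least 2. Only this threshold depends on \<open>g\<close>; the
      constants do not.\<close>
    if reg: "regular_elliptic n c" and n: "g + 4 \<le> n" for g n and c :: "'a mat"
  proof -
    define m where "m = n - g"
    define G where "G = real (card (GL g :: 'a mat set))"
    define X where "X = q powr ((real n + real g)\<^sup>2 / 2)"
    define w where "w = (\<lambda>a. q powr - ((2 * real a - real m)\<^sup>2 / 2))"
    note c = regular_elliptic_kernels[OF reg]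
    have X: "0 < X" using q by (simp add: X_def)
    have G: "q ^ (g * g) / 16 \<le> G" "G \<le> q ^ (g * g)"
      using card_GL_ge[of g, where 'a = 'a] card_GL_le[of g, where 'a = 'a]
      unfolding G_def q_def of_nat_power[symmetric] of_nat_le_iff by simp_all
    have "0 < G" using G(1) q by (smt (verit) divide_pos_pos zero_less_power)
    have N: "N_genus g n c = (\<Sum>a\<le>m. card (coincidence_GL n c a (m - a)))"
      unfolding m_def using c n by (intro N_genus_eq_sum GL_if_mat_kernel_trivial) auto
    have pow: "q ^ (n * n) = X / q ^ (g * g) * w a * q ^ (a * a + (m - a) * (m - a))" if "a \<le> m" for a
    proof -
      have "a + (m - a) + g = n" "real a - real (m - a) = 2 * real a - real m"
        using that n by (auto simp: m_def of_nat_diff)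
      with powr_genus_exponent[of q a "m - a" g n] q show ?thesis by (simp add: X_def w_def)
    qed
    have upper: "real (card (coincidence_GL n c a (m - a))) \<le> 256 * (X / q ^ (g * g)) * w a" if a: "a \<le> m" for a
    proof -
      have "real (card (coincidence_GL n c a (m - a))) * q ^ (a * a + (m - a) * (m - a))
          \<le> (256 * (X / q ^ (g * g)) * w a) * q ^ (a * a + (m - a) * (m - a))"
        using card_coincidence_GL_le[OF c, of a "m - a"] pow[OF a] a n
        by (simp add: q_def[symmetric] m_def mult.assoc)
      then show ?thesis by (rule mult_right_le_imp_le) (use q in simp)
    qed
    \<comment> \<open>The constant 1024 is 256 for each summand times 4 for the sum of the weights
      \<open>w a\<close>.\<close>
    have "real (N_genus g n c) \<le> (\<Sum>a\<le>m. 256 * (X / q ^ (g * g)) * w a)"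
      unfolding N of_nat_sum by (intro sum_mono upper) simp
    also have "\<dots> = 256 * (X / q ^ (g * g)) * (\<Sum>a\<le>m. w a)" by (simp add: sum_distrib_left)
    also have "\<dots> \<le> 256 * (X / q ^ (g * g)) * 4"
      unfolding w_def using sum_powr_square_le[OF q] X q by (intro mult_left_mono) auto
    also have "\<dots> = 1024 * (X / q ^ (g * g))" by simp
    also have "\<dots> \<le> 1024 * (X / G)"
      using G \<open>0 < G\<close> X by (intro mult_left_mono divide_left_mono mult_pos_pos) auto
    finally have le: "real (N_genus g n c) \<le> 1024 * (X / G)" .
    \<comment> \<open>For the lower bound the single most balanced term suffices; its weight is at
      least \<open>q powr - (1/2)\<close>.\<close>
    define a where "a = m div 2"
    have a: "a \<le> m" "2 \<le> a" "2 \<le> m - a" "a + (m - a) + g = n" using n by (auto simp: a_def m_def)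
    have "(X / q ^ (g * g) * w a / 65536) * q ^ (a * a + (m - a) * (m - a))
        \<le> real (card (coincidence_GL n c a (m - a))) * q ^ (a * a + (m - a) * (m - a))"
      using card_coincidence_GL_ge[OF c a(4,2,3)] pow[OF a(1)] n by (simp add: q_def[symmetric])
    then have "X / q ^ (g * g) * w a / 65536 \<le> real (card (coincidence_GL n c a (m - a)))"
      by (rule mult_right_le_imp_le) (use q in simp)
    also have "\<dots> \<le> real (N_genus g n c)"
      unfolding N of_nat_le_iff using a(1) by (intro member_le_sum) auto
    finally have ge: "X / q ^ (g * g) * w a / 65536 \<le> real (N_genus g n c)" .
    have "\<bar>2 * real a - real m\<bar> \<le> 1" unfolding a_def by linarith
    then have "(2 * real a - real m)\<^sup>2 \<le> 1" by (simp add: abs_square_le_1)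
    then have wa: "q powr - (1/2) \<le> w a" unfolding w_def using q by (intro powr_mono) auto
    have "C1 * (X / G) = X / (16 * G) * q powr - (1/2) / 65536" by (simp add: C1_def)
    also have "\<dots> \<le> X / q ^ (g * g) * w a / 65536"
      using G \<open>0 < G\<close> X q wa
      by (intro divide_right_mono mult_mono divide_left_mono mult_pos_pos) auto
    also note ge
    finally show ?thesis using le by (simp add: X_def G_def)
  qed
  then have "\<forall>\<^sub>F n in sequentially.
      C1 * (q powr ((real n + real g)\<^sup>2 / 2) / real (card (GL g :: 'a mat set))) \<le> real (N_genus g n (c n)) \<and>
      real (N_genus g n (c n)) \<le> 1024 * (q powr ((real n + real g)\<^sup>2 / 2) / real (card (GL g :: 'a mat set)))"
    if "\<forall>n\<ge>1. regular_elliptic n (c n)" for g and c :: "nat \<Rightarrow> 'a mat"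
    using that by (intro eventually_sequentiallyI[of "g + 4"]) auto
  moreover have "C1 > 0" using q by (simp add: C1_def)
  ultimately show ?thesis unfolding q_def by (intro exI[of _ C1] exI[of _ 1024]) auto
qed

end
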